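(* Let $T$ be a recursively enumerable extension of Robinson's arithmetic $\mathbf{Q}$, and fix $n\geqslant 1$. (a) All the Rosserian $\Pi_{n+1}$-sentences of $T$ are true if and only if $T$ is $\Pi_{n+1}$-sound. (b) All the Rosserian $\Sigma_{n+1}$-sentences of $T$ are true if and only if $T$ is $\Sigma_{n+1}$-sound.
   Context: All theories and sentences are in the language of first-order arithmetic; "true" means true in the standard model $\mathbb{N}$. A fixed Gödel numbering of the syntax is given; $\#A$ denotes the numeral of the Gödel code of the expression $A$, and $\overline{m}$ the numeral of $m\in\mathbb{N}$. $\mathrm{prf}_T(y,x)$ is a fixed proof predicate of $T$: a $\Delta_1$-formula (i.e. $\mathbf{Q}$-provably equivalent both to a $\Sigma_1$-formula and to a $\Pi_1$-formula) stating that "$y$ is the code of a proof in $T$ of the formula coded by $x$", which satisfies, for every sentence $\varphi$: $T\vdash\varphi$ iff $\mathbf{Q}\vdash\mathrm{prf}_T(\overline{m},\#\varphi)$ for some $m\in\mathbb{N}$; and $T\nvdash\varphi$ iff $\mathbf{Q}\vdash\neg\mathrm{prf}_T(\overline{n},\#\varphi)$ for every $n\in\mathbb{N}$. The Rosserian provability predicate of $T$ is $\mathrm{R.Pr}_T(x)=\exists y\,[\mathrm{prf}_T(y,x)\wedge\forall z<y\,\neg\mathrm{prf}_T(z,\neg x)]$, where $\neg x$ inside $\mathrm{prf}_T$ stands for the code of the negation of the formula coded by $x$ (so that $\mathrm{R.Pr}_T(\#\varphi)$ is $\exists y[\mathrm{prf}_T(y,\#\varphi)\wedge\forall z<y\,\neg\mathrm{prf}_T(z,\#[\neg\varphi])]$);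 it is a $\Sigma_1$-formula. A sentence $\rho$ is a Rosserian sentence of $T$ when $T\vdash\rho\leftrightarrow\neg\mathrm{R.Pr}_T(\#\rho)$; a Rosserian $\Gamma$-sentence is a Rosserian sentence belonging to the class $\Gamma$. For a class $\Gamma$ of sentences, a theory $S$ is $\Gamma$-sound when every $S$-provable $\Gamma$-sentence is true. The classes $\Sigma_n,\Pi_n$ are the usual arithmetical classes of formulas (as usual, a formula logically equivalent to one in the class is counted as belonging to it). *)

theory Defs
  imports "HOL-Library.Nat_Bijection"
begin

text \<open>Language of arithmetic: \<open>0, S, +, \<cdot>, =, \<le>\<close>, with de Bruijn indices for variables.\<close>

datatype tm = Var nat | Zero | Succ tm | Plus tm tm | Times tm tm

datatype fm = Eq tm tm | Le tm tm | Neg fm | Imp fm fm | All fm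

abbreviation Or :: "fm \<Rightarrow> fm \<Rightarrow> fm" where "Or p q \<equiv> Imp (Neg p) q"
abbreviation And :: "fm \<Rightarrow> fm \<Rightarrow> fm" where "And p q \<equiv> Neg (Imp p (Neg q))"
abbreviation Iff :: "fm \<Rightarrow> fm \<Rightarrow> fm" where "Iff p q \<equiv> And (Imp p q) (Imp q p)"
abbreviation Ex :: "fm \<Rightarrow> fm" where "Ex p \<equiv> Neg (All (Neg p))"
abbreviation Lt :: "tm \<Rightarrow> tm \<Rightarrow> fm" where "Lt s t \<equiv> And (Le s t) (Neg (Eq s t))"

primrec closed_tm :: "nat \<Rightarrow> tm \<Rightarrow> bool" where
  "closed_tm k (Var i) = (i < k)"
| "closed_tm k Zero = True"
| "closed_tm k (Succ t) = closed_tm k t"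
| "closed_tm k (Plus s t) = (closed_tm k s \<and> closed_tm k t)"
| "closed_tm k (Times s t) = (closed_tm k s \<and> closed_tm k t)"

text \<open>\<open>closed k p\<close>: the free variables of \<open>p\<close> are among the first \<open>k\<close> indices.\<close>

primrec closed :: "nat \<Rightarrow> fm \<Rightarrow> bool" where
  "closed k (Eq s t) = (closed_tm k s \<and> closed_tm k t)"
| "closed k (Le s t) = (closed_tm k s \<and> closed_tm k t)"
| "closed k (Neg p) = closed k p"
| "closed k (Imp p q) = (closed k p \<and> closed k q)"
| "closed k (All p) = closed (Suc k) p"

abbreviation sentence :: "fm \<Rightarrow> bool" where "sentence \<equiv> closed 0"

primrec subst_tm :: "(nat \<Rightarrow> tm) \<Rightarrow> tm \<Rightarrow> tm" where
  "subst_tm \<sigma> (Var i) = \<sigma> i"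
| "subst_tm \<sigma> Zero = Zero"
| "subst_tm \<sigma> (Succ t) = Succ (subst_tm \<sigma> t)"
| "subst_tm \<sigma> (Plus s t) = Plus (subst_tm \<sigma> s) (subst_tm \<sigma> t)"
| "subst_tm \<sigma> (Times s t) = Times (subst_tm \<sigma> s) (subst_tm \<sigma> t)"

abbreviation lift_tm :: "tm \<Rightarrow> tm" where "lift_tm \<equiv> subst_tm (\<lambda>i. Var (Suc i))"

primrec subst :: "(nat \<Rightarrow> tm) \<Rightarrow> fm \<Rightarrow> fm" where
  "subst \<sigma> (Eq s t) = Eq (subst_tm \<sigma> s) (subst_tm \<sigma> t)"
| "subst \<sigma> (Le s t) = Le (subst_tm \<sigma> s) (subst_tm \<sigma> t)"
| "subst \<sigma> (Neg p) = Neg (subst \<sigma> p)"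
| "subst \<sigma> (Imp p q) = Imp (subst \<sigma> p) (subst \<sigma> q)"
| "subst \<sigma> (All p) = All (subst (case_nat (Var 0) (\<lambda>i. lift_tm (\<sigma> i))) p)"

abbreviation lift :: "fm \<Rightarrow> fm" where "lift \<equiv> subst (\<lambda>i. Var (Suc i))"

abbreviation inst :: "fm \<Rightarrow> tm \<Rightarrow> fm" where "inst p t \<equiv> subst (case_nat t Var) p"

text \<open>\<open>inst2 p s t\<close> is \<open>p(s,t)\<close> for a formula \<open>p\<close> whose first and second argument are
  the variables with index 0 and 1.\<close>

abbreviation inst2 :: "fm \<Rightarrow> tm \<Rightarrow> tm \<Rightarrow> fm" where
  "inst2 p s t \<equiv> subst (case_nat s (case_nat t Var)) p"

primrec num :: "nat \<Rightarrow> tm" where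
  "num 0 = Zero"
| "num (Suc n) = Succ (num n)"


text \<open>Classical natural deduction with equality. In \<open>AllI\<close> the lifting of the hypotheses
  expresses the eigenvariable condition.\<close>

inductive derives :: "fm set \<Rightarrow> fm \<Rightarrow> bool" (infix "\<turnstile>" 50) where
  Assm: "p \<in> H \<Longrightarrow> H \<turnstile> p"
| ImpI: "insert p H \<turnstile> q \<Longrightarrow> H \<turnstile> Imp p q"
| ImpE: "H \<turnstile> Imp p q \<Longrightarrow> H \<turnstile> p \<Longrightarrow> H \<turnstile> q"
| Contr: "insert (Neg p) H \<turnstile> q \<Longrightarrow> insert (Neg p) H \<turnstile> Neg q \<Longrightarrow> H \<turnstile> p"
| AllI: "lift ` H \<turnstile> p \<Longrightarrow> H \<turnstile> All p"
| AllE: "H \<turnstile> All p \<Longrightarrow> H \<turnstile> inst p t"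
| EqRefl: "H \<turnstile> Eq t t"
| EqSubst: "H \<turnstile> Eq s t \<Longrightarrow> H \<turnstile> inst p s \<Longrightarrow> H \<turnstile> inst p t"

primrec val :: "(nat \<Rightarrow> nat) \<Rightarrow> tm \<Rightarrow> nat" where
  "val e (Var i) = e i"
| "val e Zero = 0"
| "val e (Succ t) = Suc (val e t)"
| "val e (Plus s t) = val e s + val e t"
| "val e (Times s t) = val e s * val e t"

primrec sat :: "(nat \<Rightarrow> nat) \<Rightarrow> fm \<Rightarrow> bool" where
  "sat e (Eq s t) = (val e s = val e t)"
| "sat e (Le s t) = (val e s \<le> val e t)"
| "sat e (Neg p) = (\<not> sat e p)"
| "sat e (Imp p q) = (sat e p \<longrightarrow> sat e q)"
| "sat e (All p) = (\<forall>x. sat (case_nat x e) p)"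

text \<open>Truth of a sentence in the standard model; the assignment is immaterial.\<close>

definition true_in_N :: "fm \<Rightarrow> bool" where
  "true_in_N p \<longleftrightarrow> sat (\<lambda>_. 0) p"

definition Q :: "fm set" where
  "Q = {All (Neg (Eq (Succ (Var 0)) Zero)),
        All (All (Imp (Eq (Succ (Var 1)) (Succ (Var 0))) (Eq (Var 1) (Var 0)))),
        All (Imp (Neg (Eq (Var 0) Zero)) (Ex (Eq (Var 1) (Succ (Var 0))))),
        All (Eq (Plus (Var 0) Zero) (Var 0)),
        All (All (Eq (Plus (Var 1) (Succ (Var 0))) (Succ (Plus (Var 1) (Var 0))))),
        All (Eq (Times (Var 0) Zero) Zero),
        All (All (Eq (Times (Var 1) (Succ (Var 0))) (Plus (Times (Var 1) (Var 0)) (Var 1)))),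
        All (All (Iff (Le (Var 1) (Var 0)) (Ex (Eq (Plus (Var 0) (Var 2)) (Var 1)))))}"


inductive Delta0 :: "fm \<Rightarrow> bool" where
  "Delta0 (Eq s t)"
| "Delta0 (Le s t)"
| "Delta0 p \<Longrightarrow> Delta0 (Neg p)"
| "Delta0 p \<Longrightarrow> Delta0 q \<Longrightarrow> Delta0 (Imp p q)"
| "Delta0 p \<Longrightarrow> Delta0 (All (Imp (Le (Var 0) (lift_tm t)) p))"

text \<open>The syntactic classes; each quantifier alternation is a block of quantifiers.\<close>

inductive strict_Sigma :: "nat \<Rightarrow> fm \<Rightarrow> bool" and strict_Pi :: "nat \<Rightarrow> fm \<Rightarrow> bool" where
  "Delta0 p \<Longrightarrow> strict_Sigma 0 p"
| "Delta0 p \<Longrightarrow> strict_Pi 0 p"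
| "strict_Pi n p \<Longrightarrow> strict_Sigma (Suc n) p"
| "strict_Sigma (Suc n) p \<Longrightarrow> strict_Sigma (Suc n) (Ex p)"
| "strict_Sigma n p \<Longrightarrow> strict_Pi (Suc n) p"
| "strict_Pi (Suc n) p \<Longrightarrow> strict_Pi (Suc n) (All p)"

definition Sigma_fms :: "nat \<Rightarrow> fm set" where
  "Sigma_fms n = {p. \<exists>q. strict_Sigma n q \<and> {} \<turnstile> Iff p q}"

definition Pi_fms :: "nat \<Rightarrow> fm set" where
  "Pi_fms n = {p. \<exists>q. strict_Pi n q \<and> {} \<turnstile> Iff p q}"

definition Sigma_sentences :: "nat \<Rightarrow> fm set" where
  "Sigma_sentences n = {p \<in> Sigma_fms n. sentence p}"

definition Pi_sentences :: "nat \<Rightarrow> fm set" where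
  "Pi_sentences n = {p \<in> Pi_fms n. sentence p}"

definition sound_for :: "fm set \<Rightarrow> fm set \<Rightarrow> bool" where
  "sound_for \<Gamma> T \<longleftrightarrow> (\<forall>p\<in>\<Gamma>. T \<turnstile> p \<longrightarrow> true_in_N p)"


text \<open>Goedel numbering. It is arranged so that the code of a negation is the value of an
  arithmetical term in the code of the negated formula.\<close>

primrec code_tm :: "tm \<Rightarrow> nat" where
  "code_tm (Var i) = 5 * i"
| "code_tm Zero = 1"
| "code_tm (Succ t) = 5 * code_tm t + 2"
| "code_tm (Plus s t) = 5 * prod_encode (code_tm s, code_tm t) + 3"
| "code_tm (Times s t) = 5 * prod_encode (code_tm s, code_tm t) + 4"

primrec code :: "fm \<Rightarrow> nat" where
  "code (Neg p) = 5 * code p + 1"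
| "code (Eq s t) = 5 * prod_encode (code_tm s, code_tm t)"
| "code (Le s t) = 5 * prod_encode (code_tm s, code_tm t) + 2"
| "code (Imp p q) = 5 * prod_encode (code p, code q) + 3"
| "code (All p) = 5 * code p + 4"

definition neg_tm :: "tm \<Rightarrow> tm" where
  "neg_tm t = Succ (Times (num 5) t)"

lemma code_tm_inj: "code_tm s = code_tm t \<longleftrightarrow> s = t"
proof (induction s arbitrary: t)
  case (Var i) then show ?case by (cases t) (auto | presburger)+
next
  case Zero then show ?case by (cases t) (auto | presburger)+
next
  case (Succ s) then show ?case by (cases t) (auto | presburger)+
next
  case (Plus s1 s2) then show ?case by (cases t) (auto | presburger)+
next
  case (Times s1 s2) then show ?case by (cases t) (auto | presburger)+
qed

lemma code_inj: "code p = code q \<longleftrightarrow> p = q"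
proof (induction p arbitrary: q)
  case (Eq s t) then show ?case by (cases q) (auto simp: code_tm_inj | presburger)+
next
  case (Le s t) then show ?case by (cases q) (auto simp: code_tm_inj | presburger)+
next
  case (Neg p) then show ?case by (cases q) (auto | presburger)+
next
  case (Imp p1 p2) then show ?case by (cases q) (auto | presburger)+
next
  case (All p) then show ?case by (cases q) (auto | presburger)+
qed

lemma val_neg_tm: "val e t = code p \<Longrightarrow> val e (neg_tm t) = code (Neg p)"
  by (simp add: neg_tm_def eval_nat_numeral)


text \<open>Partial recursive functions. A set is recursively enumerable if it is the domain of one.\<close>

datatype recf = RZero | RSucc | RProj nat | RComp recf "recf list" | RPrim recf recf | RMin recf

inductive computes :: "recf \<Rightarrow> nat list \<Rightarrow> nat \<Rightarrow> bool" where
  "computes RZero xs 0"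
| "computes RSucc [x] (Suc x)"
| "i < length xs \<Longrightarrow> computes (RProj i) xs (xs ! i)"
| "list_all2 (\<lambda>g y. computes g xs y) gs ys \<Longrightarrow> computes f ys z \<Longrightarrow> computes (RComp f gs) xs z"
| "computes f xs z \<Longrightarrow> computes (RPrim f g) (0 # xs) z"
| "computes (RPrim f g) (n # xs) y \<Longrightarrow> computes g (n # y # xs) z
    \<Longrightarrow> computes (RPrim f g) (Suc n # xs) z"
| "computes f (n # xs) 0 \<Longrightarrow> (\<forall>m<n. \<exists>y. computes f (m # xs) (Suc y))
    \<Longrightarrow> computes (RMin f) xs n"

definition re_set :: "nat set \<Rightarrow> bool" where
  "re_set A \<longleftrightarrow> (\<exists>f. A = {n. \<exists>y. computes f [n] y})"

text \<open>A theory is given by a set \<open>T\<close> of sentences (its axioms).\<close>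

definition re_extension_of_Q :: "fm set \<Rightarrow> bool" where
  "re_extension_of_Q T \<longleftrightarrow>
     (\<forall>p\<in>T. sentence p) \<and> re_set (code ` T) \<and> (\<forall>p. sentence p \<longrightarrow> Q \<turnstile> p \<longrightarrow> T \<turnstile> p)"


definition Q_equiv_to :: "fm set \<Rightarrow> fm \<Rightarrow> bool" where
  "Q_equiv_to \<Gamma> p \<longleftrightarrow> (\<exists>q\<in>\<Gamma>. Q \<turnstile> Iff p q)"

text \<open>\<open>P\<close> stands for \<open>prf\<^sub>T(y,x)\<close>, with \<open>y\<close> the variable 0 and \<open>x\<close> the variable 1.\<close>

definition proof_predicate :: "fm set \<Rightarrow> fm \<Rightarrow> bool" where
  "proof_predicate T P \<longleftrightarrow>
     closed 2 P \<and> Q_equiv_to (Sigma_fms 1) P \<and> Q_equiv_to (Pi_fms 1) P \<and>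
     (\<forall>p. sentence p \<longrightarrow>
        (T \<turnstile> p \<longleftrightarrow> (\<exists>m. Q \<turnstile> inst2 P (num m) (num (code p)))) \<and>
        (\<not> T \<turnstile> p \<longleftrightarrow> (\<forall>m. Q \<turnstile> Neg (inst2 P (num m) (num (code p))))))"

text \<open>\<open>\<exists>y [P(y,s) \<and> \<forall>z<y. \<not> P(z,t)]\<close>\<close>

definition rosser :: "fm \<Rightarrow> tm \<Rightarrow> tm \<Rightarrow> fm" where
  "rosser P s t =
     Ex (And (inst2 P (Var 0) (lift_tm s))
             (All (Imp (Lt (Var 0) (Var 1)) (Neg (inst2 P (Var 0) (lift_tm (lift_tm t)))))))"

text \<open>The formula \<open>R.Pr\<^sub>T(x)\<close> with \<open>x\<close> the variable 0, and its instance at the code of a sentence,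
  in which the negation of the argument is again given by a numeral. By \<open>val_neg_tm\<close> and the
  evaluation of closed terms in \<open>Q\<close> the latter is \<open>Q\<close>-equivalent to the substitution instance.
  For an arbitrary \<open>P\<close> that is \<open>\<Delta>\<^sub>1\<close> in \<open>Q\<close>, \<open>Q\<close> need not prove \<open>RPr P\<close> equivalent to a
  \<open>\<Sigma>\<^sub>1\<close>-formula, for lack of collection; this is a separate assumption on \<open>P\<close>.\<close>

definition RPr :: "fm \<Rightarrow> fm" where
  "RPr P = rosser P (Var 0) (neg_tm (Var 0))"

definition RPr_at :: "fm \<Rightarrow> fm \<Rightarrow> fm" where
  "RPr_at P p = rosser P (num (code p)) (num (code (Neg p)))"

definition rosserian :: "fm set \<Rightarrow> fm \<Rightarrow> fm \<Rightarrow> bool" where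
  "rosserian T P r \<longleftrightarrow> sentence r \<and> T \<turnstile> Iff r (Neg (RPr_at P r))"

end

theory Submission
  imports Defs
begin

text \<open>Write \<open>\<Gamma>\<close> for \<open>\<Pi>\<^bsub>n+1\<^esub>\<close> or \<open>\<Sigma>\<^bsub>n+1\<^esub>\<close>. As \<open>n \<ge> 1\<close>, the class \<open>\<Gamma>\<close> contains the \<open>\<Sigma>\<^sub>1\<close>- and the
  \<open>\<Pi>\<^sub>1\<close>-sentences, and it is closed under conjunction and disjunction.

  Suppose that all Rosserian \<open>\<Gamma>\<close>-sentences are true and that \<open>T\<close> proves the \<open>\<Gamma>\<close>-sentence \<open>\<psi>\<close>.
  Diagonalization yields a \<open>\<Gamma>\<close>-sentence \<open>\<rho>\<close> that \<open>Q\<close> proves equivalent to \<open>\<psi> \<and> \<not> R.Pr(\<rho>)\<close>. As \<open>T\<close>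
  proves \<open>\<psi>\<close>, the sentence \<open>\<rho>\<close> is Rosserian, so it is true, and hence so is \<open>\<psi>\<close>.

  Conversely let \<open>T\<close> be \<open>\<Gamma>\<close>-sound, thus consistent, and let \<open>\<rho>\<close> be a Rosserian \<open>\<Gamma>\<close>-sentence. If
  \<open>T\<close> proved \<open>\<rho>\<close>, then it would prove the \<open>\<Pi>\<^sub>1\<close>-sentence \<open>\<not> R.Pr(\<rho>)\<close>, which would be true by soundness;
  but \<open>R.Pr(\<rho>)\<close> is true, for \<open>\<rho>\<close> has a proof and \<open>\<not> \<rho>\<close> has none. Hence \<open>\<rho>\<close> has no proof and
  \<open>R.Pr(\<rho>)\<close> is false. Now \<open>T\<close> proves the \<open>\<Gamma>\<close>-sentence \<open>\<rho> \<or> R.Pr(\<rho>)\<close>, which is therefore true,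
  and so \<open>\<rho>\<close> is true. Both directions are in \<open>rosserian_true_iff_sound\<close>.

  Two pieces of background carry this. Derivability is handled through its completeness theorem
  (\<open>completeness\<close>): logical equivalences, such as the prenex operations behind the closure
  properties of the classes, and provability in \<open>Q\<close> and in \<open>T\<close> are established by arguing in an
  arbitrary model. The fixed points (\<open>fixed_point_Pi\<close>, \<open>fixed_point_Sigma\<close>) need a formula of low
  complexity for the graph of the diagonal function. Here the diagonalization of \<open>\<delta>\<close> is
  \<open>\<forall>x (x = #\<delta> \<longrightarrow> \<delta>)\<close>, so that its code is a polynomial in the code of \<open>\<delta>\<close> and the code of the
  numeral of that code. The codes of numerals grow exponentially, and a single number that encodes
  the course of the recursion \<open>c(0) = 1, c(i+1) = 5 c(i) + 2\<close> defines them by a \<open>\<Delta>\<^sub>0\<close>-formula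
  with a witness. Asking for the least witness turns this definition in \<open>\<nat>\<close> into one that is
  provably functional in \<open>Q\<close> (\<open>representable\<close>).\<close>

section \<open>Structures and soundness\<close>

text \<open>The universe is a set and not a whole type: the model built in the completeness proof consists
  of chosen representatives of classes of terms, which form only a part of the type of terms.\<close>

record 'a struct =
  univ :: "'a set"
  null :: 'a
  succ :: "'a \<Rightarrow> 'a"
  add :: "'a \<Rightarrow> 'a \<Rightarrow> 'a"
  mul :: "'a \<Rightarrow> 'a \<Rightarrow> 'a"
  leq :: "'a \<Rightarrow> 'a \<Rightarrow> bool"

definition wf_struct :: "'a struct \<Rightarrow> bool" where
  "wf_struct M \<longleftrightarrow> null M \<in> univ M \<and> (\<forall>a\<in>univ M. succ M a \<in> univ M) \<and>
     (\<forall>a\<in>univ M. \<forall>b\<in>univ M. add M a b \<in> univ M \<and> mul M a b \<in> univ M)"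

primrec ev :: "'a struct \<Rightarrow> (nat \<Rightarrow> 'a) \<Rightarrow> tm \<Rightarrow> 'a" where
  "ev M e (Var i) = e i"
| "ev M e Zero = null M"
| "ev M e (Succ t) = succ M (ev M e t)"
| "ev M e (Plus s t) = add M (ev M e s) (ev M e t)"
| "ev M e (Times s t) = mul M (ev M e s) (ev M e t)"

primrec holds :: "'a struct \<Rightarrow> (nat \<Rightarrow> 'a) \<Rightarrow> fm \<Rightarrow> bool" where
  "holds M e (Eq s t) = (ev M e s = ev M e t)"
| "holds M e (Le s t) = leq M (ev M e s) (ev M e t)"
| "holds M e (Neg p) = (\<not> holds M e p)"
| "holds M e (Imp p q) = (holds M e p \<longrightarrow> holds M e q)"
| "holds M e (All p) = (\<forall>x\<in>univ M. holds M (case_nat x e) p)"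

definition assignment :: "'a struct \<Rightarrow> (nat \<Rightarrow> 'a) \<Rightarrow> bool" where
  "assignment M e \<longleftrightarrow> (\<forall>i. e i \<in> univ M)"

text \<open>Free variables of the members of \<open>H\<close> are read universally; for sets of sentences this is the
  usual notion.\<close>

definition model :: "'a struct \<Rightarrow> fm set \<Rightarrow> bool" where
  "model M H \<longleftrightarrow> wf_struct M \<and> (\<forall>h\<in>H. \<forall>e. assignment M e \<longrightarrow> holds M e h)"

lemma assignment_case_nat [simp]:
  "assignment M (case_nat a e) \<longleftrightarrow> a \<in> univ M \<and> assignment M e"
  unfolding assignment_def by (metis old.nat.simps(4,5) not0_implies_Suc)

lemma ev_in_univ: "wf_struct M \<Longrightarrow> assignment M e \<Longrightarrow> ev M e t \<in> univ M"
  by (induction t) (auto simp: wf_struct_def assignment_def)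

lemma ev_cong: "closed_tm k t \<Longrightarrow> \<forall>i<k. e i = e' i \<Longrightarrow> ev M e t = ev M e' t"
  by (induction t) auto

lemma holds_cong: "closed k p \<Longrightarrow> \<forall>i<k. e i = e' i \<Longrightarrow> holds M e p = holds M e' p"
proof (induction p arbitrary: k e e')
  case (Eq s t)
  from Eq(1) show ?case by (simp add: ev_cong[OF _ Eq(2)])
next
  case (Le s t)
  from Le(1) show ?case by (simp add: ev_cong[OF _ Le(2)])
next
  case (Neg p)
  from Neg.prems(1) show ?case by (simp add: Neg.IH[OF _ Neg.prems(2)])
next
  case (Imp p q)
  from Imp.prems(1) show ?case by (simp add: Imp.IH[OF _ Imp.prems(2)])
next
  case (All p)
  have "holds M (case_nat x e) p = holds M (case_nat x e') p" for x
    using All.prems by (intro All.IH[of "Suc k"]) (auto split: nat.split)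
  then show ?case by simp
qed

lemma ev_subst: "ev M e (subst_tm \<sigma> t) = ev M (\<lambda>i. ev M e (\<sigma> i)) t"
  by (induction t) auto

lemma holds_subst: "holds M e (subst \<sigma> p) = holds M (\<lambda>i. ev M e (\<sigma> i)) p"
proof (induction p arbitrary: e \<sigma>)
  case (All p)
  have "(\<lambda>i. ev M (case_nat x e) (case_nat (Var 0) (\<lambda>i. lift_tm (\<sigma> i)) i))
      = case_nat x (\<lambda>i. ev M e (\<sigma> i))" for x
    by (auto simp: ev_subst split: nat.split)
  then show ?case by (simp add: All.IH)
qed (auto simp: ev_subst)

lemma holds_lift [simp]: "holds M (case_nat x e) (lift p) = holds M e p"
  by (simp add: holds_subst)

lemma ev_case_nat: "(\<lambda>i. ev M e (case_nat t \<sigma> i)) = case_nat (ev M e t) (\<lambda>i. ev M e (\<sigma> i))"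
  by (auto split: nat.split)

lemma holds_inst: "holds M e (inst p t) = holds M (case_nat (ev M e t) e) p"
  by (simp add: holds_subst ev_case_nat)

theorem soundness:
  assumes "H \<turnstile> p" "wf_struct M" "assignment M e" "\<And>h. h \<in> H \<Longrightarrow> holds M e h"
  shows "holds M e p"
  using assms
proof (induction arbitrary: e rule: derives.induct)
  case (ImpI p H q)
  then show ?case by (metis holds.simps(4) insertE)
next
  case (Contr p H q)
  then show ?case by (metis holds.simps(3) insertE)
next
  case (AllI H p)
  then show ?case by (auto intro!: AllI.IH)
next
  case (AllE H p t)
  then show ?case by (simp add: holds_inst ev_in_univ)
next
  case (EqSubst H s t p)
  then show ?case by (simp add: holds_inst)
qed auto

corollary soundness_model:
  "H \<turnstile> p \<Longrightarrow> model M H \<Longrightarrow> assignment M e \<Longrightarrow> holds M e p"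
  by (rule soundness) (auto simp: model_def)

section \<open>Completeness\<close>

lemma subst_tm_cong: "closed_tm k t \<Longrightarrow> \<forall>i<k. \<sigma> i = \<tau> i \<Longrightarrow> subst_tm \<sigma> t = subst_tm \<tau> t"
  by (induction t) auto

lemma subst_cong: "closed k p \<Longrightarrow> \<forall>i<k. \<sigma> i = \<tau> i \<Longrightarrow> subst \<sigma> p = subst \<tau> p"
proof (induction p arbitrary: k \<sigma> \<tau>)
  case (Eq s t)
  from Eq(1) show ?case by (simp add: subst_tm_cong[OF _ Eq(2)])
next
  case (Le s t)
  from Le(1) show ?case by (simp add: subst_tm_cong[OF _ Le(2)])
next
  case (Neg p)
  from Neg.prems(1) show ?case by (simp add: Neg.IH[OF _ Neg.prems(2)])
next
  case (Imp p q)
  from Imp.prems(1) show ?case by (simp add: Imp.IH[OF _ Imp.prems(2)])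
next
  case (All p)
  have "subst (case_nat (Var 0) (\<lambda>i. lift_tm (\<sigma> i))) p = subst (case_nat (Var 0) (\<lambda>i. lift_tm (\<tau> i))) p"
    using All.prems by (intro All.IH[of "Suc k"]) (auto split: nat.split)
  then show ?case by simp
qed

lemma subst_tm_comp: "subst_tm \<sigma> (subst_tm \<tau> t) = subst_tm (\<lambda>i. subst_tm \<sigma> (\<tau> i)) t"
  by (induction t) auto

lemma subst_comp: "subst \<sigma> (subst \<tau> p) = subst (\<lambda>i. subst_tm \<sigma> (\<tau> i)) p"
proof (induction p arbitrary: \<sigma> \<tau>)
  case (All p)
  have "(\<lambda>i. subst_tm (case_nat (Var 0) (\<lambda>i. lift_tm (\<sigma> i))) (case_nat (Var 0) (\<lambda>i. lift_tm (\<tau> i)) i))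
    = case_nat (Var 0) (\<lambda>i. lift_tm (subst_tm \<sigma> (\<tau> i)))"
    by (auto simp: subst_tm_comp split: nat.split)
  then show ?case by (simp add: All.IH)
qed (auto simp: subst_tm_comp)

lemma subst_tm_Var [simp]: "subst_tm Var t = t"
  by (induction t) auto

lemma case_nat_Var [simp]: "case_nat (Var 0) (\<lambda>i. Var (Suc i)) = Var"
  by (auto split: nat.split)

lemma subst_Var [simp]: "subst Var p = p"
  by (induction p) auto

lemma case_nat_subst_tm: 
  "(\<lambda>i. subst_tm \<sigma> (case_nat t \<tau> i)) = case_nat (subst_tm \<sigma> t) (\<lambda>i. subst_tm \<sigma> (\<tau> i))"
  by (auto split: nat.split)

lemma subst_inst: 
  "subst \<sigma> (inst p t) = inst (subst (case_nat (Var 0) (\<lambda>i. lift_tm (\<sigma> i))) p) (subst_tm \<sigma> t)"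
  by (simp add: subst_comp subst_tm_comp case_nat_subst_tm)

lemma subst_lift:
  "subst (case_nat (Var 0) (\<lambda>i. lift_tm (\<sigma> i))) (lift p) = lift (subst \<sigma> p)"
  by (simp add: subst_comp)

text \<open>Derivability is closed under substitution. In the case of \<open>AllI\<close> the substitution passes under
  the binder, where lifting and substitution commute (\<open>subst_lift\<close>).\<close>

lemma derives_subst: "H \<turnstile> p \<Longrightarrow> subst \<sigma> ` H \<turnstile> subst \<sigma> p"
proof (induction arbitrary: \<sigma> rule: derives.induct)
  case (Assm p H)
  then show ?case by (auto intro: derives.Assm)
next
  case (ImpI p H q)
  then show ?case by (auto intro: derives.ImpI)
next
  case (ImpE H p q)
  then show ?case by (auto intro: derives.ImpE)
next
  case (Contr p H q)
  have "insert (Neg (subst \<sigma> p)) (subst \<sigma> ` H) \<turnstile> subst \<sigma> q"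
    "insert (Neg (subst \<sigma> p)) (subst \<sigma> ` H) \<turnstile> Neg (subst \<sigma> q)"
    using Contr.IH[of \<sigma>] by simp_all
  then show ?case by (rule derives.Contr)
next
  case (AllI H p)
  have "lift ` subst \<sigma> ` H = subst (case_nat (Var 0) (\<lambda>i. lift_tm (\<sigma> i))) ` lift ` H"
    by (simp add: image_image subst_lift)
  then show ?case using AllI.IH by (auto intro: derives.AllI)
next
  case (AllE H p t)
  then show ?case by (simp add: subst_inst[of \<sigma> t p] derives.AllE)
next
  case (EqRefl H t)
  then show ?case by (simp add: derives.EqRefl)
next
  case (EqSubst H s t p)
  have "subst \<sigma> ` H \<turnstile> Eq (subst_tm \<sigma> s) (subst_tm \<sigma> t)" using EqSubst.IH(1)[of \<sigma>] by simp
  then show ?case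
    using EqSubst.IH(2)[of \<sigma>] unfolding subst_inst[of \<sigma> s p] subst_inst[of \<sigma> t p]
    by (rule derives.EqSubst)
qed

lemma derives_mono: "H \<turnstile> p \<Longrightarrow> H \<subseteq> H' \<Longrightarrow> H' \<turnstile> p"
proof (induction arbitrary: H' rule: derives.induct)
  case (ImpI p H q)
  then show ?case by (meson derives.ImpI insert_mono)
next
  case (Contr p H q)
  then show ?case by (meson derives.Contr insert_mono)
next
  case (AllI H p)
  from AllI.prems show ?case by (intro derives.AllI AllI.IH image_mono)
qed (blast intro: derives.intros)+

lemma derives_finite: "H \<turnstile> p \<Longrightarrow> \<exists>F. finite F \<and> F \<subseteq> H \<and> F \<turnstile> p"
proof (induction rule: derives.induct)
  case (Assm p H)
  then show ?case by (intro exI[of _ "{p}"]) (auto intro: derives.Assm)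
next
  case (ImpI p H q)
  then obtain F where "finite F" "F \<subseteq> insert p H" "F \<turnstile> q" by blast
  then show ?case
    by (intro exI[of _ "F - {p}"]) (auto intro!: derives.ImpI elim!: derives_mono)
next
  case (ImpE H p q)
  then obtain F G where "finite F" "F \<subseteq> H" "F \<turnstile> Imp p q" "finite G" "G \<subseteq> H" "G \<turnstile> p" by blast
  then show ?case
    by (intro exI[of _ "F \<union> G"]) (auto intro: derives.ImpE[of _ p] elim!: derives_mono)
next
  case (Contr p H q)
  then obtain F G where "finite F" "F \<subseteq> insert (Neg p) H" "F \<turnstile> q" 
    "finite G" "G \<subseteq> insert (Neg p) H" "G \<turnstile> Neg q" by blast
  then show ?case
    by (intro exI[of _ "(F \<union> G) - {Neg p}"]) (auto intro!: derives.Contr[of p _ q] elim!: derives_mono)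
next
  case (AllI H p)
  then obtain F where "finite F" "F \<subseteq> lift ` H" "F \<turnstile> p" by blast
  then obtain G where "finite G" "G \<subseteq> H" "F = lift ` G" by (metis finite_subset_image)
  then show ?case using \<open>F \<turnstile> p\<close> by (auto intro: derives.AllI)
next
  case (AllE H p t)
  then show ?case by (blast intro: derives.AllE)
next
  case (EqRefl H t)
  then show ?case by (auto intro: derives.EqRefl)
next
  case (EqSubst H s t p)
  then obtain F G where "finite F" "F \<subseteq> H" "F \<turnstile> Eq s t" "finite G" "G \<subseteq> H" "G \<turnstile> inst p s" by blast
  then show ?case
    by (intro exI[of _ "F \<union> G"]) (auto intro: derives.EqSubst[of _ s t] elim!: derives_mono)
qed

lemma closed_tm_mono: "closed_tm k t \<Longrightarrow> k \<le> l \<Longrightarrow> closed_tm l t"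
  by (induction t) auto

lemma closed_mono: "closed k p \<Longrightarrow> k \<le> l \<Longrightarrow> closed l p"
proof (induction p arbitrary: k l)
  case (All p)
  then show ?case using All.IH[of "Suc k" "Suc l"] by simp
next
  case (Imp p q)
  then show ?case using Imp.IH[of k l] by simp
qed (auto intro: closed_tm_mono)

lemma ex_closed_tm: "\<exists>k. closed_tm k t"
proof (induction t)
  case (Var i)
  then show ?case by (auto intro: exI[of _ "Suc i"])
next
  case (Plus s t)
  then show ?case by (metis closed_tm.simps(4) closed_tm_mono nat_le_linear)
next
  case (Times s t)
  then show ?case by (metis closed_tm.simps(5) closed_tm_mono nat_le_linear)
qed auto

lemma ex_closed: "\<exists>k. closed k p"
proof (induction p)
  case (Eq s t)
  then show ?case by (metis ex_closed_tm closed.simps(1) closed_tm_mono nat_le_linear)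
next
  case (Le s t)
  then show ?case by (metis ex_closed_tm closed.simps(2) closed_tm_mono nat_le_linear)
next
  case (Imp p q)
  then show ?case by (metis closed.simps(4) closed_mono nat_le_linear)
next
  case (All p)
  then show ?case by (metis closed.simps(5) closed_mono lessI less_imp_le)
qed auto

text \<open>Generalization over a fresh variable \<open>k\<close>. The renaming that sends \<open>k\<close> to \<open>0\<close> and moves the
  variables below \<open>k\<close> up by one lifts the hypotheses and turns \<open>inst p (Var k)\<close> back into \<open>p\<close>,
  which is the premise of \<open>AllI\<close>.\<close>

lemma generalize_fresh:
  assumes "\<And>h. h \<in> H \<Longrightarrow> closed k h" "closed k (All p)" "H \<turnstile> inst p (Var k)"
  shows "H \<turnstile> All p"
proof -
  define \<tau> where "\<tau> i = (if i = k then Var 0 else Var (Suc i))" for i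
  have "subst \<tau> ` H = lift ` H"
    by (intro image_cong refl subst_cong[of k]) (auto simp: \<tau>_def assms(1))
  moreover have "subst \<tau> (inst p (Var k)) = subst Var p"
    unfolding subst_comp using assms(2)
    by (intro subst_cong[of "Suc k"]) (auto simp: \<tau>_def split: nat.split)
  ultimately show ?thesis
    using derives_subst[OF assms(3), of \<tau>] by (auto intro: AllI)
qed

definition consistent :: "fm set \<Rightarrow> bool" where
  "consistent H \<longleftrightarrow> \<not> (\<exists>p. H \<turnstile> p \<and> H \<turnstile> Neg p)"

lemma inconsistent_derives: "\<not> consistent H \<Longrightarrow> H \<turnstile> p"
  unfolding consistent_def by (meson Contr derives_mono subset_insertI)

lemma inconsistent_insert_Neg: "\<not> consistent (insert (Neg p) H) \<Longrightarrow> H \<turnstile> p"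
  unfolding consistent_def by (meson Contr)

lemma derives_cut: "H \<turnstile> p \<Longrightarrow> insert p H \<turnstile> q \<Longrightarrow> H \<turnstile> q"
  by (meson ImpE ImpI)

lemma inconsistent_insert: 
  assumes "\<not> consistent (insert p H)" shows "H \<turnstile> Neg p"
proof (rule inconsistent_insert_Neg)
  have "insert (Neg (Neg p)) H \<turnstile> p"
    by (rule Contr[of _ _ "Neg p"]) (auto intro: Assm)
  moreover have "insert p (insert (Neg (Neg p)) H) \<turnstile> q" for q
    using inconsistent_derives[OF assms] by (rule derives_mono) auto
  ultimately have "insert (Neg (Neg p)) H \<turnstile> q" for q by (rule derives_cut)
  then show "\<not> consistent (insert (Neg (Neg p)) H)" by (auto simp: consistent_def)
qed

text \<open>For such a set a fresh variable is available, and it remains so after adding finitely many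
  formulas.\<close>

definition bounded_vars :: "fm set \<Rightarrow> bool" where
  "bounded_vars H \<longleftrightarrow> (\<exists>k. \<forall>h\<in>H. closed k h)"

lemma bounded_vars_insert [simp]: "bounded_vars (insert p H) \<longleftrightarrow> bounded_vars H"
proof
  assume "bounded_vars H"
  then obtain k where k: "\<forall>h\<in>H. closed k h" by (auto simp: bounded_vars_def)
  obtain l where "closed l p" using ex_closed by blast
  then have "\<forall>h\<in>insert p H. closed (max k l) h"
    using k closed_mono[of k _ "max k l"] closed_mono[of l _ "max k l"] by auto
  then show "bounded_vars (insert p H)" unfolding bounded_vars_def ..
qed (auto simp: bounded_vars_def)

text \<open>One step of Henkin's construction: \<open>p\<close> is added if this is consistent, together with a
  counterexample instance if \<open>p\<close> is a negated universal formula.\<close>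

definition extends :: "fm \<Rightarrow> fm set \<Rightarrow> fm set \<Rightarrow> bool" where
  "extends p H H' \<longleftrightarrow> H \<subseteq> H' \<and> consistent H' \<and> bounded_vars H' \<and>
     (consistent (insert p H) \<longrightarrow> p \<in> H' \<and> (\<forall>q. p = Neg (All q) \<longrightarrow> (\<exists>t. Neg (inst q t) \<in> H')))"

lemma ex_extends:
  assumes "consistent H" "bounded_vars H"
  shows "\<exists>H'. extends p H H'"
proof (cases "consistent (insert p H)")
  case False
  then show ?thesis using assms by (auto simp: extends_def)
next
  case cons: True
  show ?thesis
  proof (cases "\<exists>q. p = Neg (All q)")
    case False
    then show ?thesis using assms cons by (intro exI[of _ "insert p H"]) (auto simp: extends_def)
  next
    case True
    then obtain q where q: "p = Neg (All q)" by blast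
    from assms(2) have "bounded_vars (insert p H)" by simp
    then obtain k where k: "\<And>h. h \<in> insert p H \<Longrightarrow> closed k h"
      by (auto simp only: bounded_vars_def)
    have "consistent (insert (Neg (inst q (Var k))) (insert p H))"
    proof (rule ccontr)
      assume "\<not> ?thesis"
      then have "insert p H \<turnstile> inst q (Var k)" by (rule inconsistent_insert_Neg)
      moreover have "closed k (All q)" using k[of p] q by simp
      ultimately have "insert p H \<turnstile> All q" using k generalize_fresh by blast
      moreover have "insert p H \<turnstile> Neg (All q)" using q by (auto intro: Assm)
      ultimately show False using cons by (auto simp: consistent_def)
    qed
    then show ?thesis using assms q
      by (intro exI[of _ "insert (Neg (inst q (Var k))) (insert p H)"]) (auto simp: extends_def)
  qed
qed

lemma consistent_Union:
  assumes "\<And>n. consistent (S n)" "\<And>n. S n \<subseteq> S (Suc n)"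
  shows "consistent (\<Union>n. S n)"
proof (rule ccontr)
  assume "\<not> ?thesis"
  then obtain p where p: "(\<Union>n. S n) \<turnstile> p" "(\<Union>n. S n) \<turnstile> Neg p" by (auto simp: consistent_def)
  have mono: "m \<le> n \<Longrightarrow> S m \<subseteq> S n" for m n using assms(2) by (rule lift_Suc_mono_le)
  have *: "\<exists>n. S n \<turnstile> q" if "(\<Union>n. S n) \<turnstile> q" for q
  proof -
    from derives_finite[OF that] obtain F where F: "finite F" "F \<subseteq> (\<Union>n. S n)" "F \<turnstile> q" by blast
    have "\<exists>n. F \<subseteq> S n" using F(1,2)
    proof (induction rule: finite_induct)
      case (insert x F)
      then obtain m n where "F \<subseteq> S m" "x \<in> S n" by auto
      then have "insert x F \<subseteq> S (max m n)"
        using mono[of m "max m n"] mono[of n "max m n"] by auto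
      then show ?case ..
    qed auto
    then show ?thesis using F(3) derives_mono by blast
  qed
  obtain m n where "S m \<turnstile> p" "S n \<turnstile> Neg p" using *[OF p(1)] *[OF p(2)] by blast
  then have "S (max m n) \<turnstile> p" "S (max m n) \<turnstile> Neg p"
    using mono[of m "max m n"] mono[of n "max m n"] derives_mono by auto
  then show False using assms(1) by (auto simp: consistent_def)
qed

text \<open>The formulas are treated one by one in the order of their codes.\<close>

lemma henkin_extension:
  assumes "consistent H" "bounded_vars H"
  obtains S where "H \<subseteq> S" "consistent S" "\<And>p. p \<in> S \<or> S \<turnstile> Neg p"
    "\<And>q. Neg (All q) \<in> S \<Longrightarrow> \<exists>t. Neg (inst q t) \<in> S"
proof -
  define enum where "enum n = (THE p. code p = n)" for n
  have enum: "enum (code p) = p" for p by (simp add: enum_def code_inj)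
  define S where "S = rec_nat H (\<lambda>n X. SOME Y. extends (enum n) X Y)"
  have S_Suc: "S (Suc n) = (SOME Y. extends (enum n) (S n) Y)" for n by (simp add: S_def)
  have S: "consistent (S n) \<and> bounded_vars (S n)" for n
  proof (induction n)
    case 0
    then show ?case using assms by (simp add: S_def)
  next
    case (Suc n)
    then have "extends (enum n) (S n) (S (Suc n))"
      unfolding S_Suc by (metis ex_extends someI_ex)
    then show ?case by (auto simp: extends_def)
  qed
  then have ext: "extends (enum n) (S n) (S (Suc n))" for n
    unfolding S_Suc by (metis ex_extends someI_ex)
  have cons: "consistent (\<Union>n. S n)"
    using S ext by (intro consistent_Union) (auto simp: extends_def)
  show ?thesis
  proof
    show "H \<subseteq> (\<Union>n. S n)" using UN_upper[of 0 UNIV S] by (simp add: S_def)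
    show "consistent (\<Union>n. S n)" by (rule cons)
    show "p \<in> (\<Union>n. S n) \<or> (\<Union>n. S n) \<turnstile> Neg p" for p
    proof (cases "consistent (insert p (S (code p)))")
      case True
      then show ?thesis using ext[of "code p"] by (auto simp: extends_def enum)
    next
      case False
      then show ?thesis using inconsistent_insert derives_mono by (metis UN_upper UNIV_I)
    qed
    show "\<exists>t. Neg (inst q t) \<in> (\<Union>n. S n)" if q: "Neg (All q) \<in> (\<Union>n. S n)" for q
    proof -
      have "consistent (insert (Neg (All q)) (S n))" for n
        using cons q derives_mono[of "insert (Neg (All q)) (S n)" _ "\<Union>n. S n"]
        unfolding consistent_def by blast
      then show ?thesis using ext[of "code (Neg (All q))"] unfolding extends_def enum by blast
    qed
  qed
qed

text \<open>The term model of a Henkin extension \<open>S\<close>. Its elements are representatives of the terms modulo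
  provable equality, and an assignment is \<open>rep\<close> applied to a substitution \<open>\<sigma>\<close>. The truth lemma is
  proved in the form that \<open>p\<close> holds at such an assignment iff \<open>subst \<sigma> p\<close> belongs to \<open>S\<close>; for
  arbitrary \<open>\<sigma>\<close> it goes through the quantifier without any replacement of equals inside formulas.\<close>

lemma model_existence:
  assumes "consistent H" "bounded_vars H"
  shows "\<exists>(M :: tm struct) e. wf_struct M \<and> assignment M e \<and> (\<forall>h\<in>H. holds M e h)"
proof -
  obtain S where HS: "H \<subseteq> S" and cons: "consistent S" and max: "\<And>p. p \<in> S \<or> S \<turnstile> Neg p"
    and wit: "\<And>q. Neg (All q) \<in> S \<Longrightarrow> \<exists>t. Neg (inst q t) \<in> S"
    using henkin_extension[OF assms] by blast
  have ded: "S \<turnstile> p \<longleftrightarrow> p \<in> S" for p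
    using cons max by (auto simp: consistent_def intro: Assm)
  have neg: "Neg p \<in> S \<longleftrightarrow> p \<notin> S" for p
    using cons max ded by (auto simp: consistent_def)
  have imp: "Imp p q \<in> S \<longleftrightarrow> (p \<in> S \<longrightarrow> q \<in> S)" for p q
  proof
    show "p \<in> S \<longrightarrow> q \<in> S" if "Imp p q \<in> S" using that ImpE ded by blast
    assume *: "p \<in> S \<longrightarrow> q \<in> S"
    show "Imp p q \<in> S"
    proof (cases "q \<in> S")
      case True
      then show ?thesis using ded by (meson Assm ImpI insertI2)
    next
      case False
      then have "insert p S \<turnstile> Neg p" "insert p S \<turnstile> p" using * neg by (auto intro: Assm)
      then have "insert p S \<turnstile> q" by (auto intro: inconsistent_derives simp: consistent_def)
      then show ?thesis using ded ImpI by blast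
    qed
  qed
  have all: "All p \<in> S \<longleftrightarrow> (\<forall>t. inst p t \<in> S)" for p
    using AllE ded wit neg by meson
  have eq_refl: "Eq t t \<in> S" for t using EqRefl ded by blast
  have eq_subst: "Eq s t \<in> S \<Longrightarrow> inst p s \<in> S \<Longrightarrow> inst p t \<in> S" for s t p
    using EqSubst ded by blast
  have [simp]: "subst_tm (\<lambda>i. case_nat t Var (Suc i)) s = s" for s t by simp
  \<comment> \<open>Each property of equality is an instance of Leibniz replacement in a formula with one free place.\<close>
  have eq_sym: "Eq s t \<in> S \<Longrightarrow> Eq t s \<in> S" for s t
    using eq_subst[of s t "Eq (Var 0) (lift_tm s)"] eq_refl[of s] by (simp add: subst_tm_comp)
  have eq_trans: "Eq s t \<in> S \<Longrightarrow> Eq t u \<in> S \<Longrightarrow> Eq s u \<in> S" for s t u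
    using eq_subst[of t u "Eq (lift_tm s) (Var 0)"] by (simp add: subst_tm_comp)
  have cong_succ: "Eq s t \<in> S \<Longrightarrow> Eq (Succ s) (Succ t) \<in> S" for s t
    using eq_subst[of s t "Eq (Succ (lift_tm s)) (Succ (Var 0))"] eq_refl by (simp add: subst_tm_comp)
  have cong_plus: "Eq s t \<in> S \<Longrightarrow> Eq s' t' \<in> S \<Longrightarrow> Eq (Plus s s') (Plus t t') \<in> S" for s t s' t'
    using eq_subst[of s t "Eq (Plus (lift_tm s) (lift_tm s')) (Plus (Var 0) (lift_tm s'))"]
      eq_subst[of s' t' "Eq (Plus (lift_tm s) (lift_tm s')) (Plus (lift_tm t) (Var 0))"]
      eq_refl by (simp add: subst_tm_comp)
  have cong_times: "Eq s t \<in> S \<Longrightarrow> Eq s' t' \<in> S \<Longrightarrow> Eq (Times s s') (Times t t') \<in> S" for s t s' t'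
    using eq_subst[of s t "Eq (Times (lift_tm s) (lift_tm s')) (Times (Var 0) (lift_tm s'))"]
      eq_subst[of s' t' "Eq (Times (lift_tm s) (lift_tm s')) (Times (lift_tm t) (Var 0))"]
      eq_refl by (simp add: subst_tm_comp)
  have cong_le: "Eq s t \<in> S \<Longrightarrow> Eq s' t' \<in> S \<Longrightarrow> Le s s' \<in> S \<Longrightarrow> Le t t' \<in> S" for s t s' t'
    using eq_subst[of s t "Le (Var 0) (lift_tm s')"]
      eq_subst[of s' t' "Le (lift_tm t) (Var 0)"] by (simp add: subst_tm_comp)
  define rep where "rep t = (SOME u. Eq t u \<in> S)" for t
  have rep: "Eq t (rep t) \<in> S" for t
    unfolding rep_def by (rule someI[of _ t]) (rule eq_refl)
  have rep_eq: "rep s = rep t \<longleftrightarrow> Eq s t \<in> S" for s t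
  proof
    show "Eq s t \<in> S" if "rep s = rep t" using rep[of s] rep[of t] that eq_sym eq_trans by metis
    show "rep s = rep t" if "Eq s t \<in> S"
    proof -
      have "(\<lambda>u. Eq s u \<in> S) = (\<lambda>u. Eq t u \<in> S)" using that eq_sym eq_trans by blast
      then show ?thesis by (simp add: rep_def)
    qed
  qed
  define M :: "tm struct" where "M = \<lparr>univ = range rep, null = rep Zero, succ = rep \<circ> Succ,
    add = (\<lambda>s t. rep (Plus s t)), mul = (\<lambda>s t. rep (Times s t)), leq = (\<lambda>s t. Le s t \<in> S)\<rparr>"
  have evM: "ev M (\<lambda>i. rep (\<sigma> i)) t = rep (subst_tm \<sigma> t)" for \<sigma> t
  proof (induction t)
    case (Succ t)
    then show ?case by (simp add: M_def rep_eq eq_sym cong_succ rep)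
  next
    case (Plus s t)
    then show ?case by (simp add: M_def rep_eq) (meson cong_plus eq_sym rep)
  next
    case (Times s t)
    then show ?case by (simp add: M_def rep_eq) (meson cong_times eq_sym rep)
  qed (simp_all add: M_def)
  have holdsM: "holds M (\<lambda>i. rep (\<sigma> i)) p \<longleftrightarrow> subst \<sigma> p \<in> S" for \<sigma> p
  proof (induction p arbitrary: \<sigma>)
    case (Eq s t)
    then show ?case by (simp add: evM rep_eq)
  next
    case (Le s t)
    then show ?case by (simp add: evM) (simp add: M_def, meson cong_le eq_sym rep)
  next
    case (All p)
    have "case_nat (rep t) (\<lambda>i. rep (\<sigma> i)) = (\<lambda>i. rep (case_nat t \<sigma> i))" for t
      by (auto split: nat.split)
    moreover have "inst (subst (case_nat (Var 0) (\<lambda>i. lift_tm (\<sigma> i))) p) t = subst (case_nat t \<sigma>) p" for t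
      by (simp add: subst_comp subst_tm_comp case_nat_subst_tm)
    moreover have "univ M = range rep" by (simp add: M_def)
    ultimately show ?case by (simp add: all All.IH)
  qed (auto simp: neg imp)
  have "wf_struct M" by (auto simp: wf_struct_def M_def)
  moreover have "assignment M (\<lambda>i. rep (Var i))" by (auto simp: assignment_def M_def)
  moreover have "\<forall>h\<in>H. holds M (\<lambda>i. rep (Var i)) h" using holdsM[of Var] HS by auto
  ultimately show ?thesis by blast
qed

text \<open>Requiring sentences in \<open>H\<close> keeps all variables fresh for Henkin's construction; only those of
  \<open>p\<close> are taken.\<close>

theorem completeness:
  assumes "\<And>h. h \<in> H \<Longrightarrow> sentence h"
    and "\<And>(M :: tm struct) e. model M H \<Longrightarrow> assignment M e \<Longrightarrow> holds M e p"
  shows "H \<turnstile> p"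
proof (rule inconsistent_insert_Neg, rule notI)
  assume cons: "consistent (insert (Neg p) H)"
  have "bounded_vars H" using assms(1) by (auto simp: bounded_vars_def)
  then have "bounded_vars (insert (Neg p) H)" by simp
  from model_existence[OF cons this] obtain M :: "tm struct" and e where
    M: "wf_struct M" "assignment M e" "\<And>h. h \<in> H \<Longrightarrow> holds M e h" "\<not> holds M e p" by auto
  have "holds M e' h" if "h \<in> H" for e' h
    using M(3)[OF that] holds_cong[of 0 h e e' M] assms(1)[OF that] by simp
  then have "model M H" using M(1) by (simp add: model_def)
  then show False using assms(2) M(2,4) by blast
qed

section \<open>The arithmetical hierarchy up to logical equivalence\<close>

lemma holds_Iff [simp]: "holds M e (Iff p q) \<longleftrightarrow> (holds M e p \<longleftrightarrow> holds M e q)"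
  by auto

lemma holds_equiv:
  "{} \<turnstile> Iff p q \<Longrightarrow> wf_struct M \<Longrightarrow> assignment M e \<Longrightarrow> holds M e p = holds M e q"
  by (drule soundness) (auto simp del: holds.simps)

lemma equivI:
  "(\<And>(M :: tm struct) e. wf_struct M \<Longrightarrow> assignment M e \<Longrightarrow> holds M e p = holds M e q) \<Longrightarrow> {} \<turnstile> Iff p q"
  by (rule completeness) (auto simp: model_def simp del: holds.simps)

text \<open>Since the classes are closed under logical equivalence, membership may be shown by comparing
  truth values in all structures with a formula that is already known to belong to the class.\<close>

lemma Sigma_fms_cong:
  assumes "q \<in> Sigma_fms n"
    and "\<And>(M :: tm struct) e. wf_struct M \<Longrightarrow> assignment M e \<Longrightarrow> holds M e p = holds M e q"
  shows "p \<in> Sigma_fms n"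
proof -
  from assms(1) obtain r where r: "strict_Sigma n r" "{} \<turnstile> Iff q r" by (auto simp: Sigma_fms_def)
  have "{} \<turnstile> Iff p r" by (rule equivI) (use assms(2) holds_equiv[OF r(2)] in blast)
  with r(1) show ?thesis by (auto simp: Sigma_fms_def)
qed

lemma Pi_fms_cong:
  assumes "q \<in> Pi_fms n"
    and "\<And>(M :: tm struct) e. wf_struct M \<Longrightarrow> assignment M e \<Longrightarrow> holds M e p = holds M e q"
  shows "p \<in> Pi_fms n"
proof -
  from assms(1) obtain r where r: "strict_Pi n r" "{} \<turnstile> Iff q r" by (auto simp: Pi_fms_def)
  have "{} \<turnstile> Iff p r" by (rule equivI) (use assms(2) holds_equiv[OF r(2)] in blast)
  with r(1) show ?thesis by (auto simp: Pi_fms_def)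
qed

lemma strict_Sigma_fms: "strict_Sigma n p \<Longrightarrow> p \<in> Sigma_fms n"
  unfolding Sigma_fms_def by (auto intro!: exI[of _ p] equivI)

lemma strict_Pi_fms: "strict_Pi n p \<Longrightarrow> p \<in> Pi_fms n"
  unfolding Pi_fms_def by (auto intro!: exI[of _ p] equivI)

lemma Sigma_fmsE:
  assumes "p \<in> Sigma_fms n"
  obtains q where "strict_Sigma n q"
    "\<And>(M :: tm struct) e. wf_struct M \<Longrightarrow> assignment M e \<Longrightarrow> holds M e p = holds M e q"
  using assms holds_equiv unfolding Sigma_fms_def by blast

lemma Pi_fmsE:
  assumes "p \<in> Pi_fms n"
  obtains q where "strict_Pi n q"
    "\<And>(M :: tm struct) e. wf_struct M \<Longrightarrow> assignment M e \<Longrightarrow> holds M e p = holds M e q"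
  using assms holds_equiv unfolding Pi_fms_def by blast

lemma strict_Suc:
  shows strict_Sigma_Suc: "strict_Sigma n p \<Longrightarrow> strict_Sigma (Suc n) p"
    and strict_Pi_Suc: "strict_Pi n p \<Longrightarrow> strict_Pi (Suc n) p"
  by (induction rule: strict_Sigma_strict_Pi.inducts) (blast intro: strict_Sigma_strict_Pi.intros)+

lemma Pi_fms_subset_Sigma_fms: "Pi_fms n \<subseteq> Sigma_fms (Suc n)"
  by (auto simp: Sigma_fms_def Pi_fms_def intro: strict_Sigma_strict_Pi.intros)

lemma Sigma_fms_subset_Pi_fms: "Sigma_fms n \<subseteq> Pi_fms (Suc n)"
  by (auto simp: Sigma_fms_def Pi_fms_def intro: strict_Sigma_strict_Pi.intros)

lemma Sigma_fms_mono: "m \<le> n \<Longrightarrow> Sigma_fms m \<subseteq> Sigma_fms n"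
  by (rule lift_Suc_mono_le[of Sigma_fms]) (auto simp: Sigma_fms_def intro: strict_Suc)

lemma Pi_fms_mono: "m \<le> n \<Longrightarrow> Pi_fms m \<subseteq> Pi_fms n"
  by (rule lift_Suc_mono_le[of Pi_fms]) (auto simp: Pi_fms_def intro: strict_Suc)

lemma Ex_Sigma_fms: "p \<in> Sigma_fms (Suc n) \<Longrightarrow> Ex p \<in> Sigma_fms (Suc n)"
  by (erule Sigma_fmsE, rule Sigma_fms_cong[OF strict_Sigma_fms[OF strict_Sigma_strict_Pi.intros(4)]]) auto

lemma All_Pi_fms: "p \<in> Pi_fms (Suc n) \<Longrightarrow> All p \<in> Pi_fms (Suc n)"
  by (erule Pi_fmsE, rule Pi_fms_cong[OF strict_Pi_fms[OF strict_Sigma_strict_Pi.intros(6)]]) auto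

lemma strict_Neg_fms:
  shows "strict_Sigma n p \<Longrightarrow> Neg p \<in> Pi_fms n" and "strict_Pi n p \<Longrightarrow> Neg p \<in> Sigma_fms n"
proof (induction rule: strict_Sigma_strict_Pi.inducts)
  case (1 p)
  then show ?case by (auto intro: strict_Pi_fms strict_Sigma_strict_Pi.intros Delta0.intros)
next
  case (2 p)
  then show ?case by (auto intro: strict_Sigma_fms strict_Sigma_strict_Pi.intros Delta0.intros)
next
  case (3 n p)
  then show ?case using Sigma_fms_subset_Pi_fms by blast
next
  case (4 n p)
  show ?case by (rule Pi_fms_cong[OF All_Pi_fms[OF 4(2)]]) simp
next
  case (5 n p)
  then show ?case using Pi_fms_subset_Sigma_fms by blast
next
  case (6 n p)
  show ?case by (rule Sigma_fms_cong[OF Ex_Sigma_fms[OF 6(2)]]) simp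
qed

lemma Neg_Sigma_fms: "p \<in> Sigma_fms n \<Longrightarrow> Neg p \<in> Pi_fms n"
  by (erule Sigma_fmsE, rule Pi_fms_cong[OF strict_Neg_fms(1)]) auto

lemma Neg_Pi_fms: "p \<in> Pi_fms n \<Longrightarrow> Neg p \<in> Sigma_fms n"
  by (erule Pi_fmsE, rule Sigma_fms_cong[OF strict_Neg_fms(2)]) auto

lemma Delta0_subst: "Delta0 p \<Longrightarrow> Delta0 (subst \<sigma> p)"
proof (induction arbitrary: \<sigma> rule: Delta0.induct)
  case (5 p t)
  have "subst_tm (case_nat (Var 0) (\<lambda>i. lift_tm (\<sigma> i))) (lift_tm t) = lift_tm (subst_tm \<sigma> t)"
    by (simp add: subst_tm_comp)
  then show ?case using 5 by (auto intro: Delta0.intros)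
qed (auto intro: Delta0.intros)

lemma strict_subst:
  shows "strict_Sigma n p \<Longrightarrow> strict_Sigma n (subst \<sigma> p)"
    and "strict_Pi n p \<Longrightarrow> strict_Pi n (subst \<sigma> p)"
  by (induction arbitrary: \<sigma> and \<sigma> rule: strict_Sigma_strict_Pi.inducts)
    (auto intro: strict_Sigma_strict_Pi.intros Delta0_subst)

lemma assignment_ev: "wf_struct M \<Longrightarrow> assignment M e \<Longrightarrow> assignment M (\<lambda>i. ev M e (\<sigma> i))"
  by (simp add: assignment_def ev_in_univ[unfolded assignment_def])

lemma subst_Sigma_fms: "p \<in> Sigma_fms n \<Longrightarrow> subst \<sigma> p \<in> Sigma_fms n"
  by (erule Sigma_fmsE, rule Sigma_fms_cong[OF strict_Sigma_fms[OF strict_subst(1)]])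
    (auto simp: holds_subst assignment_ev)

lemma subst_Pi_fms: "p \<in> Pi_fms n \<Longrightarrow> subst \<sigma> p \<in> Pi_fms n"
  by (erule Pi_fmsE, rule Pi_fms_cong[OF strict_Pi_fms[OF strict_subst(2)]])
    (auto simp: holds_subst assignment_ev)

text \<open>A \<open>\<Sigma>\<^bsub>n+1\<^esub>\<close>-formula is a \<open>\<Pi>\<^sub>n\<close>-formula behind a block of existential quantifiers.\<close>

lemma strict_Sigma_Suc_induct [consumes 1, case_names Pi Ex]:
  assumes "strict_Sigma (Suc n) p" "\<And>p. strict_Pi n p \<Longrightarrow> R p" "\<And>p. R p \<Longrightarrow> R (Ex p)"
  shows "R p"
proof -
  have "m = Suc n \<longrightarrow> R p" if "strict_Sigma m p" for m
    using that
    by (induction rule: strict_Sigma_strict_Pi.inducts(1)[where ?P2.0 = "\<lambda>_ _. True"])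
      (auto intro: assms(2,3))
  then show ?thesis using assms(1) by blast
qed

lemma strict_Pi_Suc_induct [consumes 1, case_names Sigma All]:
  assumes "strict_Pi (Suc n) p" "\<And>p. strict_Sigma n p \<Longrightarrow> R p" "\<And>p. R p \<Longrightarrow> R (All p)"
  shows "R p"
proof -
  have "m = Suc n \<longrightarrow> R p" if "strict_Pi m p" for m
    using that
    by (induction rule: strict_Sigma_strict_Pi.inducts(2)[where ?P1.0 = "\<lambda>_ _. True"])
      (auto intro: assms(2,3))
  then show ?thesis using assms(1) by blast
qed

lemma ex_univ: "wf_struct M \<Longrightarrow> \<exists>x. x \<in> univ M"
  by (auto simp: wf_struct_def)

text \<open>The quantifier blocks of the two conjuncts are pulled out one quantifier at a time, while the
  other conjunct is lifted. For universal quantifiers this needs a nonempty universe.\<close>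

lemma strict_And_fms:
  shows "\<And>p q. strict_Sigma n p \<Longrightarrow> strict_Sigma n q \<Longrightarrow> And p q \<in> Sigma_fms n"
    and "\<And>p q. strict_Pi n p \<Longrightarrow> strict_Pi n q \<Longrightarrow> And p q \<in> Pi_fms n"
proof (induction n)
  case 0
  fix p q
  have *: "Delta0 p \<Longrightarrow> Delta0 q \<Longrightarrow> Delta0 (And p q)" by (intro Delta0.intros)
  show "strict_Sigma 0 p \<Longrightarrow> strict_Sigma 0 q \<Longrightarrow> And p q \<in> Sigma_fms 0"
    by (auto elim!: strict_Sigma.cases intro!: strict_Sigma_fms strict_Sigma_strict_Pi.intros *)
  show "strict_Pi 0 p \<Longrightarrow> strict_Pi 0 q \<Longrightarrow> And p q \<in> Pi_fms 0"
    by (auto elim!: strict_Pi.cases intro!: strict_Pi_fms strict_Sigma_strict_Pi.intros *)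
next
  case (Suc n)
  fix p q
  show "And p q \<in> Sigma_fms (Suc n)" if p: "strict_Sigma (Suc n) p" and q: "strict_Sigma (Suc n) q"
    using p q
  proof (induction p arbitrary: q rule: strict_Sigma_Suc_induct)
    case (Pi p)
    from Pi(2,1) show ?case
    proof (induction q arbitrary: p rule: strict_Sigma_Suc_induct)
      case (Pi q)
      then show ?case using Suc.IH(2) Pi_fms_subset_Sigma_fms by blast
    next
      case (Ex q)
      have "And (lift p) q \<in> Sigma_fms (Suc n)" by (rule Ex.IH) (rule strict_subst(2)[OF Ex.prems])
      then show ?case
        by (rule Sigma_fms_cong[OF Ex_Sigma_fms]) auto
    qed
  next
    case (Ex p)
    have "And p (lift q) \<in> Sigma_fms (Suc n)" by (rule Ex.IH) (rule strict_subst(1)[OF Ex.prems])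
    then show ?case
      by (rule Sigma_fms_cong[OF Ex_Sigma_fms]) auto
  qed
  show "And p q \<in> Pi_fms (Suc n)" if p: "strict_Pi (Suc n) p" and q: "strict_Pi (Suc n) q"
    using p q
  proof (induction p arbitrary: q rule: strict_Pi_Suc_induct)
    case (Sigma p)
    from Sigma(2,1) show ?case
    proof (induction q arbitrary: p rule: strict_Pi_Suc_induct)
      case (Sigma q)
      then show ?case using Suc.IH(1) Sigma_fms_subset_Pi_fms by blast
    next
      case (All q)
      have "And (lift p) q \<in> Pi_fms (Suc n)" by (rule All.IH) (rule strict_subst(1)[OF All.prems])
      then show ?case
        by (rule Pi_fms_cong[OF All_Pi_fms]) (use ex_univ in auto)
    qed
  next
    case (All p)
    have "And p (lift q) \<in> Pi_fms (Suc n)" by (rule All.IH) (rule strict_subst(2)[OF All.prems])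
    then show ?case
      by (rule Pi_fms_cong[OF All_Pi_fms]) (use ex_univ in auto)
  qed
qed

lemma And_Sigma_fms: "p \<in> Sigma_fms n \<Longrightarrow> q \<in> Sigma_fms n \<Longrightarrow> And p q \<in> Sigma_fms n"
  by (elim Sigma_fmsE, rule Sigma_fms_cong[OF strict_And_fms(1)]) auto

lemma And_Pi_fms: "p \<in> Pi_fms n \<Longrightarrow> q \<in> Pi_fms n \<Longrightarrow> And p q \<in> Pi_fms n"
  by (elim Pi_fmsE, rule Pi_fms_cong[OF strict_And_fms(2)]) auto

lemma Imp_Sigma_fms: "p \<in> Pi_fms n \<Longrightarrow> q \<in> Sigma_fms n \<Longrightarrow> Imp p q \<in> Sigma_fms n"
  by (rule Sigma_fms_cong[OF Neg_Pi_fms[OF And_Pi_fms[OF _ Neg_Sigma_fms]]]) auto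

lemma Imp_Pi_fms: "p \<in> Sigma_fms n \<Longrightarrow> q \<in> Pi_fms n \<Longrightarrow> Imp p q \<in> Pi_fms n"
  by (rule Pi_fms_cong[OF Neg_Sigma_fms[OF And_Sigma_fms[OF _ Neg_Pi_fms]]]) auto

section \<open>Models of Robinson arithmetic\<close>

definition nat_struct :: "nat struct" where
  "nat_struct = \<lparr>univ = UNIV, null = 0, succ = Suc, add = (+), mul = (*), leq = (\<le>)\<rparr>"

lemma wf_nat_struct: "wf_struct nat_struct"
  by (simp add: wf_struct_def nat_struct_def)

lemma assignment_nat_struct: "assignment nat_struct e"
  by (simp add: assignment_def nat_struct_def)

lemma ev_nat_struct: "ev nat_struct e t = val e t"
  by (induction t) (auto simp: nat_struct_def)

lemma holds_nat_struct: "holds nat_struct e p = sat e p"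
  by (induction p arbitrary: e) (auto simp: ev_nat_struct, auto simp: nat_struct_def)

lemma model_nat_struct_Q: "model nat_struct Q"
proof -
  have "x \<le> y \<longleftrightarrow> (\<exists>z. z + x = y)" for x y :: nat by (metis add.commute le_iff_add)
  then have "sat e h" if "h \<in> Q" for h e
    using that unfolding Q_def by (auto simp: not0_implies_Suc)
  then show ?thesis by (simp add: model_def wf_nat_struct holds_nat_struct)
qed

definition std :: "'a struct \<Rightarrow> nat \<Rightarrow> 'a" where
  "std M n = (succ M ^^ n) (null M)"

lemma std_simps: "std M 0 = null M" "std M (Suc n) = succ M (std M n)"
  by (simp_all add: std_def)

lemma ev_num [simp]: "ev M e (num n) = std M n"
  by (induction n) (simp_all add: std_simps)

lemma std_in_univ: "wf_struct M \<Longrightarrow> std M n \<in> univ M"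
  by (induction n) (auto simp: std_simps wf_struct_def)

lemma std_nat_struct [simp]: "std nat_struct n = n"
  by (induction n) (simp_all add: std_simps, simp_all add: nat_struct_def)

lemma model_Q_axioms:
  assumes "model M Q"
  shows "a \<in> univ M \<Longrightarrow> succ M a \<noteq> null M"
    and "a \<in> univ M \<Longrightarrow> b \<in> univ M \<Longrightarrow> succ M a = succ M b \<Longrightarrow> a = b"
    and "a \<in> univ M \<Longrightarrow> a \<noteq> null M \<Longrightarrow> \<exists>b\<in>univ M. a = succ M b"
    and "a \<in> univ M \<Longrightarrow> add M a (null M) = a"
    and "a \<in> univ M \<Longrightarrow> b \<in> univ M \<Longrightarrow> add M a (succ M b) = succ M (add M a b)"
    and "a \<in> univ M \<Longrightarrow> mul M a (null M) = null M"
    and "a \<in> univ M \<Longrightarrow> b \<in> univ M \<Longrightarrow> mul M a (succ M b) = add M (mul M a b) a"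
    and "a \<in> univ M \<Longrightarrow> b \<in> univ M \<Longrightarrow> leq M a b \<longleftrightarrow> (\<exists>c\<in>univ M. add M c a = b)"
proof -
  have "assignment M (\<lambda>_. null M)"
    using assms by (auto simp: model_def assignment_def wf_struct_def)
  then have "\<forall>h\<in>Q. holds M (\<lambda>_. null M) h" using assms by (simp add: model_def)
  note ax = this[unfolded Q_def, simplified]
  show "a \<in> univ M \<Longrightarrow> succ M a \<noteq> null M"
    and "a \<in> univ M \<Longrightarrow> b \<in> univ M \<Longrightarrow> succ M a = succ M b \<Longrightarrow> a = b"
    and "a \<in> univ M \<Longrightarrow> a \<noteq> null M \<Longrightarrow> \<exists>b\<in>univ M. a = succ M b"
    and "a \<in> univ M \<Longrightarrow> add M a (null M) = a"
    and "a \<in> univ M \<Longrightarrow> b \<in> univ M \<Longrightarrow> add M a (succ M b) = succ M (add M a b)"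
    and "a \<in> univ M \<Longrightarrow> mul M a (null M) = null M"
    and "a \<in> univ M \<Longrightarrow> b \<in> univ M \<Longrightarrow> mul M a (succ M b) = add M (mul M a b) a"
    and "a \<in> univ M \<Longrightarrow> b \<in> univ M \<Longrightarrow> leq M a b \<longleftrightarrow> (\<exists>c\<in>univ M. add M c a = b)"
    using ax by blast+
qed

context
  fixes M :: "'a struct"
  assumes Q_model: "model M Q"
begin

lemmas Q_axioms = model_Q_axioms[OF Q_model]

lemma wfM: "wf_struct M"
  using Q_model by (simp add: model_def)

lemma stdM [simp]: "std M n \<in> univ M"
  by (rule std_in_univ[OF wfM])

lemma add_std: "add M (std M m) (std M n) = std M (m + n)"
  by (induction n) (simp_all add: std_simps Q_axioms)

lemma mul_std: "mul M (std M m) (std M n) = std M (m * n)"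
  by (induction n) (simp_all add: std_simps Q_axioms add_std add.commute)

lemma std_inj: "std M m = std M n \<longleftrightarrow> m = n"
proof (induction m arbitrary: n)
  case 0
  show ?case using Q_axioms(1) by (cases n) (auto simp: std_simps dest: sym)
next
  case (Suc m)
  show ?case
  proof (cases n)
    case 0
    then show ?thesis using Q_axioms(1) by (auto simp: std_simps)
  next
    case (Suc k)
    then show ?thesis using Suc.IH[of k] Q_axioms(2)[of "std M m" "std M k"] by (auto simp: std_simps)
  qed
qed

text \<open>Below a standard element there are only standard ones, and every element is comparable with
  every standard one (\<open>leq_std_total\<close>). The first fact gives the absoluteness of bounded formulas, and
  both together give the uniqueness of least witnesses.\<close>

lemma leq_std_imp: "a \<in> univ M \<Longrightarrow> leq M a (std M n) \<Longrightarrow> \<exists>k\<le>n. a = std M k"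
proof (induction n arbitrary: a)
  case 0
  then obtain c where c: "c \<in> univ M" "add M c a = null M"
    using Q_axioms(8)[OF 0(1) stdM, of 0] by (auto simp: std_simps)
  have "a = null M"
  proof (rule ccontr)
    assume "a \<noteq> null M"
    then obtain b where "b \<in> univ M" "a = succ M b" using Q_axioms(3) 0 by blast
    then show False using c Q_axioms(1,5) wfM by (simp add: wf_struct_def)
  qed
  then show ?case by (simp add: std_simps)
next
  case (Suc n)
  then obtain c where c: "c \<in> univ M" "add M c a = succ M (std M n)"
    using Q_axioms(8)[OF Suc.prems(1) stdM, of "Suc n"] by (auto simp: std_simps)
  show ?case
  proof (cases "a = null M")
    case True
    then show ?thesis using std_simps(1) by (metis le0)
  next
    case False
    then obtain b where b: "b \<in> univ M" "a = succ M b" using Q_axioms(3) Suc.prems by blast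
    then have "add M c b = std M n"
      using c Q_axioms(2,5) wfM by (auto simp: wf_struct_def)
    then have "leq M b (std M n)" using b c by (auto simp: Q_axioms(8))
    then obtain k where "k \<le> n" "b = std M k" using Suc.IH b by blast
    then show ?thesis using b by (auto intro!: exI[of _ "Suc k"] simp: std_simps)
  qed
qed

lemma leq_std: "leq M (std M k) (std M n) \<longleftrightarrow> k \<le> n"
proof
  show "leq M (std M k) (std M n) \<Longrightarrow> k \<le> n" using leq_std_imp[of "std M k" n] std_inj by auto
  assume "k \<le> n"
  then have "add M (std M (n - k)) (std M k) = std M n" by (simp add: add_std)
  then show "leq M (std M k) (std M n)" using Q_axioms(8) stdM by blast
qed

lemma add_succ_std: "a \<in> univ M \<Longrightarrow> add M (succ M a) (std M n) = succ M (add M a (std M n))"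
proof (induction n)
  case 0
  then show ?case using wfM by (simp add: std_simps Q_axioms wf_struct_def)
next
  case (Suc n)
  then show ?case using wfM by (simp add: std_simps Q_axioms wf_struct_def)
qed

lemma leq_std_total: "a \<in> univ M \<Longrightarrow> leq M a (std M n) \<or> leq M (std M n) a"
proof (induction n)
  case 0
  then show ?case using Q_axioms(4,8) stdM by (metis std_simps(1))
next
  case (Suc n)
  from Suc.IH[OF Suc.prems] show ?case
  proof
    assume "leq M a (std M n)"
    then obtain k where "k \<le> n" "a = std M k" using leq_std_imp Suc.prems by blast
    then show ?thesis by (simp add: leq_std)
  next
    assume "leq M (std M n) a"
    then obtain c where c: "c \<in> univ M" "add M c (std M n) = a" using Q_axioms(8) Suc.prems stdM by blast
    show ?thesis
    proof (cases "c = null M")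
      case True
      then have "a = std M n" using c add_std[of 0 n] by (simp add: std_simps)
      then show ?thesis by (simp add: leq_std)
    next
      case False
      then obtain b where b: "b \<in> univ M" "c = succ M b" using Q_axioms(3) c by blast
      have "add M b (std M (Suc n)) = a"
        using c b by (simp add: std_simps Q_axioms(5) add_succ_std)
      then show ?thesis using Q_axioms(8) b Suc.prems stdM by blast
    qed
  qed
qed

lemma ev_std: "ev M (\<lambda>i. std M (e i)) t = std M (val e t)"
  by (induction t) (simp_all add: std_simps add_std mul_std)

lemma case_nat_std: "case_nat (std M k) (\<lambda>i. std M (e i)) = (\<lambda>i. std M (case_nat k e i))"
  by (auto split: nat.split)

text \<open>Every model of \<open>Q\<close> has the standard numbers as an initial segment, so at standard
  arguments a bounded quantifier ranges over the same numbers as in \<open>\<nat>\<close>.\<close>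

theorem Delta0_absolute: "Delta0 p \<Longrightarrow> holds M (\<lambda>i. std M (e i)) p \<longleftrightarrow> sat e p"
proof (induction arbitrary: e rule: Delta0.induct)
  case (5 p t)
  have bound: "ev M (case_nat a e') (lift_tm t) = ev M e' t" for a e'
    by (simp add: ev_subst)
  have val: "val (case_nat k e) (lift_tm t) = val e t" for k
    by (simp add: ev_subst flip: ev_nat_struct)
  have "holds M (\<lambda>i. std M (e i)) (All (Imp (Le (Var 0) (lift_tm t)) p))
      \<longleftrightarrow> (\<forall>a\<in>univ M. leq M a (std M (val e t)) \<longrightarrow> holds M (case_nat a (\<lambda>i. std M (e i))) p)"
    by (simp add: bound ev_std)
  also have "\<dots> \<longleftrightarrow> (\<forall>k\<le>val e t. holds M (case_nat (std M k) (\<lambda>i. std M (e i))) p)"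
    using leq_std leq_std_imp stdM by metis
  also have "\<dots> \<longleftrightarrow> sat e (All (Imp (Le (Var 0) (lift_tm t)) p))"
    by (simp add: case_nat_std 5 val)
  finally show ?case .
qed (auto simp: ev_std std_inj leq_std)

end

section \<open>Representability\<close>

lemma closed_subst_tm: "closed_tm k t \<Longrightarrow> \<forall>i<k. closed_tm l (\<sigma> i) \<Longrightarrow> closed_tm l (subst_tm \<sigma> t)"
  by (induction t) auto

lemma closed_subst: "closed k p \<Longrightarrow> \<forall>i<k. closed_tm l (\<sigma> i) \<Longrightarrow> closed l (subst \<sigma> p)"
proof (induction p arbitrary: k l \<sigma>)
  case (All p)
  have "closed (Suc l) (subst (case_nat (Var 0) (\<lambda>i. lift_tm (\<sigma> i))) p)"
    using All.prems
    by (intro All.IH[of "Suc k"]) (auto split: nat.split intro!: closed_subst_tm[of l])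
  then show ?case by simp
next
  case (Imp p q)
  then show ?case by (auto simp only: subst.simps closed.simps)
qed (auto intro: closed_subst_tm)

text \<open>Let index 0 stand for the value \<open>y\<close>, 1 for the witness \<open>b\<close> and 2 for the argument \<open>x\<close>. The
  formula says that \<open>y \<le> b\<close> and \<open>\<theta>(y,b,x)\<close>, and that no smaller \<open>b'\<close> is a witness of any value
  \<open>y' \<le> b'\<close>.\<close>

definition least_witness :: "fm \<Rightarrow> fm" where
  "least_witness \<theta> = And (Le (Var 0) (Var 1)) (And \<theta>
     (All (Imp (Le (Var 0) (lift_tm (Var 1))) (Imp (Neg (Eq (Var 0) (Var 2)))
       (All (Imp (Le (Var 0) (lift_tm (Var 0)))
         (Neg (subst (case_nat (Var 0) (case_nat (Var 1) (\<lambda>_. Var 4))) \<theta>))))))))"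

abbreviation env3 :: "'a \<Rightarrow> 'a \<Rightarrow> 'a \<Rightarrow> nat \<Rightarrow> 'a" where
  "env3 y b x \<equiv> case_nat y (case_nat b (\<lambda>_. x))"

lemma Delta0_least_witness: "Delta0 \<theta> \<Longrightarrow> Delta0 (least_witness \<theta>)"
  unfolding least_witness_def by (intro Delta0.intros Delta0_subst)

lemma closed_least_witness: "closed 3 \<theta> \<Longrightarrow> closed 3 (least_witness \<theta>)"
  unfolding least_witness_def
  by (auto simp: less_Suc_eq numeral_eq_Suc split: nat.split intro!: closed_subst[of 3])

lemma holds_env3: 
  "closed 3 \<theta> \<Longrightarrow> holds M (case_nat y (case_nat b (case_nat x e))) \<theta> = holds M (env3 y b x) \<theta>"
  by (rule holds_cong) (auto simp: less_Suc_eq numeral_eq_Suc split: nat.split)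

lemma holds_least_witness:
  assumes "closed 3 \<theta>"
  shows "holds M (env3 y b x) (least_witness \<theta>) \<longleftrightarrow>
    leq M y b \<and> holds M (env3 y b x) \<theta> \<and>
    (\<forall>b'\<in>univ M. leq M b' b \<longrightarrow> b' \<noteq> b \<longrightarrow>
      (\<forall>y'\<in>univ M. leq M y' b' \<longrightarrow> \<not> holds M (env3 y' b' x) \<theta>))"
proof -
  have "(\<lambda>i. ev M (case_nat y' (case_nat b' (env3 y b x))) (case_nat (Var 0) (case_nat (Var (Suc 0)) (\<lambda>_. Var 4)) i))
     = env3 y' b' x" for y' b'
    by (auto simp: numeral_eq_Suc split: nat.split)
  then show ?thesis by (auto simp: least_witness_def holds_subst)
qed

text \<open>A function whose graph is given in \<open>\<nat>\<close> by a \<open>\<Delta>\<^sub>0\<close>-formula with a witness is represented in \<open>Q\<close>.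
  Let \<open>b0\<close> be the least witness in \<open>\<nat>\<close> that bounds its value. In a model of \<open>Q\<close>, an element \<open>b\<close>
  that satisfies the formula is comparable with \<open>b0\<close>. It is not above \<open>b0\<close>, as it would not be
  least then. So \<open>b\<close> is standard, and with it \<open>y \<le> b\<close>, and absoluteness applies.\<close>

theorem representable:
  assumes M: "model M Q" and \<theta>: "Delta0 \<theta>" "closed 3 \<theta>"
    and sound: "\<And>x b y. sat (env3 y b x) \<theta> \<Longrightarrow> y = f x"
    and total: "\<exists>b\<ge>f x. sat (env3 (f x) b x) \<theta>"
    and y: "y \<in> univ M"
  shows "(\<exists>b\<in>univ M. holds M (env3 y b (std M x)) (least_witness \<theta>)) \<longleftrightarrow> y = std M (f x)"
proof -
  have env: "env3 (std M k) (std M n) (std M x) = (\<lambda>i. std M (env3 k n x i))" for k n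
    by (auto split: nat.split)
  have abs: "holds M (env3 (std M k) (std M n) (std M x)) \<theta> \<longleftrightarrow> sat (env3 k n x) \<theta>" for k n
    unfolding env by (rule Delta0_absolute[OF M \<theta>(1)])
  define W where "W n \<longleftrightarrow> f x \<le> n \<and> sat (env3 (f x) n x) \<theta>" for n
  have "\<exists>n. W n" using total by (auto simp: W_def)
  define b0 where "b0 = (LEAST n. W n)"
  have W: "W b0" using \<open>\<exists>n. W n\<close> unfolding b0_def by (rule LeastI_ex)
  have least: "\<not> W n" if "n < b0" for n using that unfolding b0_def by (rule not_less_Least)
  show ?thesis
  proof
    assume y_eq: "y = std M (f x)"
    have "\<not> holds M (env3 y' b' (std M x)) \<theta>"
      if b': "b' \<in> univ M" "leq M b' (std M b0)" "b' \<noteq> std M b0" and y': "y' \<in> univ M" "leq M y' b'" for b' y'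
    proof
      assume h: "holds M (env3 y' b' (std M x)) \<theta>"
      obtain n where n: "n \<le> b0" "b' = std M n" using leq_std_imp[OF M b'(1,2)] by blast
      obtain k where k: "k \<le> n" "y' = std M k" using leq_std_imp[OF M] y' n by blast
      have "sat (env3 k n x) \<theta>" using h abs n k by simp
      then have "W n" using sound k by (auto simp: W_def)
      moreover have "n \<noteq> b0" using n b' by auto
      ultimately show False using least n by auto
    qed
    then have "holds M (env3 y (std M b0) (std M x)) (least_witness \<theta>)"
      using W y_eq by (auto simp: holds_least_witness[OF \<theta>(2)] W_def leq_std[OF M] abs)
    then show "\<exists>b\<in>univ M. holds M (env3 y b (std M x)) (least_witness \<theta>)"
      using stdM[OF M] by blast
  next
    assume "\<exists>b\<in>univ M. holds M (env3 y b (std M x)) (least_witness \<theta>)"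
    then obtain b where b: "b \<in> univ M" and "holds M (env3 y b (std M x)) (least_witness \<theta>)" by blast
    then have yb: "leq M y b" and h: "holds M (env3 y b (std M x)) \<theta>"
      and min: "\<And>b' y'. b' \<in> univ M \<Longrightarrow> leq M b' b \<Longrightarrow> b' \<noteq> b \<Longrightarrow> y' \<in> univ M \<Longrightarrow> leq M y' b'
        \<Longrightarrow> \<not> holds M (env3 y' b' (std M x)) \<theta>"
      by (auto simp: holds_least_witness[OF \<theta>(2)])
    have "leq M b (std M b0)"
    proof (rule ccontr)
      assume "\<not> ?thesis"
      then have "leq M (std M b0) b" "std M b0 \<noteq> b"
        using leq_std_total[OF M b] leq_std[OF M] by auto
      then have "\<not> holds M (env3 (std M (f x)) (std M b0) (std M x)) \<theta>"
        using min[of "std M b0" "std M (f x)"] W stdM[OF M] by (auto simp: leq_std[OF M] W_def)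
      then show False using W by (simp add: abs W_def)
    qed
    \<comment> \<open>Both \<open>b\<close> and \<open>y\<close> are standard, so that \<open>\<theta>\<close> has its meaning in \<open>\<nat>\<close>.\<close>
    then obtain n where n: "b = std M n" using leq_std_imp[OF M b] by blast
    then obtain k where k: "y = std M k" using leq_std_imp[OF M y] yb by blast
    show "y = std M (f x)" using h sound n k by (simp add: abs)
  qed
qed

section \<open>The codes of numerals\<close>

text \<open>An injective polynomial pairing with values at least 1: the square of \<open>i + z\<close> and
  \<open>i \<le> i + z\<close> can be recovered from their sum.\<close>

definition pos :: "nat \<Rightarrow> nat \<Rightarrow> nat" where
  "pos i z = Suc ((i + z) * (i + z) + i)"

text \<open>A finite set of pairs is encoded, as in Goedel's beta function, by a number \<open>w\<close>
  and a parameter \<open>d\<close>: a pair belongs to the set iff its modulus \<open>1 + pos i z * d\<close> divides \<open>w\<close>.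
  For suitable \<open>d\<close> the moduli of the pairs in a given finite range are pairwise coprime, and
  every subset of that range is the part in it of such a set.\<close>

definition marked :: "nat \<Rightarrow> nat \<Rightarrow> nat \<Rightarrow> nat \<Rightarrow> bool" where
  "marked d w i z \<longleftrightarrow> Suc (pos i z * d) dvd w"

text \<open>Every marked pair with \<open>i \<le> x\<close> and \<open>z \<le> c\<close> is an initial value or results by one step
  from another marked pair, as prescribed by \<open>code_tm (num 0) = 1\<close> and
  \<open>code_tm (num (Suc i)) = 5 * code_tm (num i) + 2\<close>. This condition already forces \<open>c\<close> to be the
  code of the numeral of \<open>x\<close>.\<close>

definition numeral_trace :: "nat \<Rightarrow> nat \<Rightarrow> nat \<Rightarrow> nat \<Rightarrow> bool" where
  "numeral_trace d w x c \<longleftrightarrow> marked d w x c \<and>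
     (\<forall>i\<le>x. \<forall>z\<le>c. marked d w i z \<longrightarrow> i = 0 \<and> z = 1 \<or>
        (\<exists>i'\<le>i. \<exists>z'\<le>z. i = Suc i' \<and> z = 5 * z' + 2 \<and> marked d w i' z'))"

lemma numeral_trace_unique:
  assumes "numeral_trace d w x c"
  shows "c = code_tm (num x)"
proof -
  have "i \<le> x \<Longrightarrow> z \<le> c \<Longrightarrow> marked d w i z \<Longrightarrow> z = code_tm (num i)" for i z
  proof (induction i arbitrary: z)
    case 0
    then show ?case using assms unfolding numeral_trace_def by force
  next
    case (Suc i)
    then obtain z' where "z' \<le> z" "z = 5 * z' + 2" "marked d w i z'"
      using assms unfolding numeral_trace_def by blast
    then show ?case using Suc by simp
  qed
  then show ?thesis using assms by (auto simp: numeral_trace_def)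
qed

lemma pos_inj: "pos i z = pos j y \<longleftrightarrow> i = j \<and> z = y"
proof
  assume eq: "pos i z = pos j y"
  have less: "pos a b < pos a' b'" if "a + b < a' + b'" for a b a' b'
  proof -
    have "(a + b) * (a + b) + a < Suc (a + b) * Suc (a + b)" by simp
    also have "\<dots> \<le> (a' + b') * (a' + b')" using that by (intro mult_le_mono) auto
    finally show ?thesis by (simp add: pos_def)
  qed
  have "i + z = j + y" using less[of i z j y] less[of j y i z] eq by linarith
  then show "i = j \<and> z = y" using eq by (simp add: pos_def)
qed auto

lemma pos_mono: "i \<le> j \<Longrightarrow> z \<le> y \<Longrightarrow> pos i z \<le> pos j y"
  unfolding pos_def by (intro Suc_le_mono[THEN iffD2] add_mono mult_mono) auto

text \<open>A common divisor of \<open>1 + k d\<close> and \<open>1 + l d\<close> is coprime to \<open>d\<close> and divides \<open>(l - k) d\<close>. So it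
  divides \<open>l - k\<close>, which divides \<open>d\<close>.\<close>

lemma coprime_moduli:
  assumes "\<And>j. 1 \<le> j \<Longrightarrow> j \<le> K \<Longrightarrow> j dvd d" and "k < l" "l \<le> K"
  shows "coprime (Suc (k * d)) (Suc (l * d))"
proof (rule coprimeI)
  fix g assume g: "g dvd Suc (k * d)" "g dvd Suc (l * d)"
  have "(l - k) * d = Suc (l * d) - Suc (k * d)" by (simp add: diff_mult_distrib)
  then have "g dvd (l - k) * d" using g dvd_diff_nat by metis
  moreover have "coprime g d"
  proof (rule coprimeI)
    fix h assume "h dvd g" "h dvd d"
    then have "h dvd Suc (k * d)" "h dvd k * d" using g dvd_trans by auto
    then show "is_unit h" using dvd_diff_nat[of h "Suc (k * d)" "k * d"] by simp
  qed
  ultimately have "g dvd l - k" by (simp add: coprime_dvd_mult_left_iff)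
  also have "l - k dvd d" using assms by auto
  finally have "g dvd k * d" by simp
  then show "is_unit g" using g dvd_diff_nat[of g "Suc (k * d)" "k * d"] by simp
qed

lemma code_num_mono: "i \<le> j \<Longrightarrow> code_tm (num i) \<le> code_tm (num j)"
  by (rule lift_Suc_mono_le) auto

text \<open>The witnesses are \<open>d = K!\<close>, where \<open>K\<close> is the largest value of \<open>pos\<close> on the
  pairs with \<open>i \<le> x\<close> and \<open>z \<le> code_tm (num x)\<close>, and the product \<open>w\<close> of the
  moduli of the pairs \<open>(i, code_tm (num i))\<close> with \<open>i \<le> x\<close>. The modulus of any other pair in the
  range is coprime to \<open>w\<close> and exceeds 1, so that no other pair is marked.\<close>

lemma numeral_trace_exists: "\<exists>d w. numeral_trace d w x (code_tm (num x))"
proof -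
  define c where "c i = code_tm (num i)" for i
  define K where "K = pos x (c x)"
  define d where "d = \<Prod>{1..K}"
  define m where "m i z = Suc (pos i z * d)" for i z
  define w where "w = (\<Prod>i\<le>x. m i (c i))"
  have d: "j dvd d" if "1 \<le> j" "j \<le> K" for j unfolding d_def using that by (intro dvd_prodI) auto
  have "d > 0" unfolding d_def by (intro prod_pos) auto
  have posK: "pos i z \<le> K" if "i \<le> x" "z \<le> c x" for i z
    unfolding K_def using that by (intro pos_mono)
  have c_mono: "i \<le> j \<Longrightarrow> c i \<le> c j" for i j by (simp add: c_def code_num_mono)
  have in_w: "marked d w i (c i)" if "i \<le> x" for i
    unfolding marked_def w_def m_def[symmetric] using that by (intro dvd_prodI) auto
  have only: "z = c i" if iz: "i \<le> x" "z \<le> c x" and mk: "marked d w i z" for i z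
  proof (rule ccontr)
    assume ne: "z \<noteq> c i"
    have "coprime (m i z) (m j (c j))" if "j \<le> x" for j
    proof -
      have "pos i z \<noteq> pos j (c j)" using ne by (auto simp: pos_inj)
      moreover have "pos i z \<le> K" "pos j (c j) \<le> K" using posK c_mono iz that by auto
      ultimately show ?thesis
        using coprime_moduli[of K d "pos i z" "pos j (c j)"] d
          coprime_moduli[of K d "pos j (c j)" "pos i z"]
        by (auto simp: m_def coprime_commute neq_iff)
    qed
    then have "coprime (m i z) w" unfolding w_def by (intro prod_coprime_right) auto
    moreover have "m i z dvd w" using mk by (simp add: marked_def m_def)
    ultimately have "m i z = 1" by (metis coprime_absorb_left nat_dvd_1_iff_1)
    then show False using \<open>d > 0\<close> by (simp add: m_def pos_def)
  qed
  have "numeral_trace d w x (c x)"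
    unfolding numeral_trace_def
  proof (intro conjI allI impI)
    show "marked d w x (c x)" by (rule in_w) simp
    fix i z assume iz: "i \<le> x" "z \<le> c x" "marked d w i z"
    then have z: "z = c i" by (rule only)
    show "i = 0 \<and> z = 1 \<or> (\<exists>i'\<le>i. \<exists>z'\<le>z. i = Suc i' \<and> z = 5 * z' + 2 \<and> marked d w i' z')"
    proof (cases i)
      case 0
      then show ?thesis using z by (simp add: c_def)
    next
      case (Suc i')
      then have "z = 5 * c i' + 2" "marked d w i' (c i')" using z iz in_w by (auto simp: c_def)
      then show ?thesis using Suc by (intro disjI2 exI[of _ i'] exI[of _ "c i'"] conjI) auto
    qed
  qed
  then show ?thesis by (auto simp: c_def)
qed

section \<open>The graph of the diagonal function\<close>

text \<open>Equivalent to substituting the numeral of \<open>code p\<close> for the variable of \<open>p\<close>, but with a code that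
  is computed from \<open>code p\<close> without any recursion on \<open>p\<close>.\<close>

definition diag :: "fm \<Rightarrow> fm" where
  "diag p = All (Imp (Eq (Var 0) (num (code p))) p)"

definition diag_code :: "nat \<Rightarrow> nat" where
  "diag_code x = 5 * (5 * prod_encode (5 * prod_encode (0, code_tm (num x)), x) + 3) + 4"

lemma code_diag: "code (diag p) = diag_code (code p)"
  by (simp add: diag_def diag_code_def)

definition BAll :: "tm \<Rightarrow> fm \<Rightarrow> fm" where
  "BAll t p = All (Imp (Le (Var 0) (lift_tm t)) p)"

definition BEx :: "tm \<Rightarrow> fm \<Rightarrow> fm" where
  "BEx t p = Neg (BAll t (Neg p))"

lemma Delta0_BAll: "Delta0 p \<Longrightarrow> Delta0 (BAll t p)"
  unfolding BAll_def by (rule Delta0.intros)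

lemma Delta0_BEx: "Delta0 p \<Longrightarrow> Delta0 (BEx t p)"
  unfolding BEx_def by (intro Delta0.intros Delta0_BAll)

lemma val_lift [simp]: "val (case_nat a e) (lift_tm t) = val e t"
  by (induction t) auto

lemma sat_BAll [simp]: "sat e (BAll t p) \<longleftrightarrow> (\<forall>a\<le>val e t. sat (case_nat a e) p)"
  by (simp add: BAll_def)

lemma sat_BEx [simp]: "sat e (BEx t p) \<longleftrightarrow> (\<exists>a\<le>val e t. sat (case_nat a e) p)"
  by (simp add: BEx_def)

lemma closed_lift_tm [simp]: "closed_tm (Suc k) (lift_tm t) \<longleftrightarrow> closed_tm k t"
  by (induction t) auto

lemma closed_BAll [simp]: "closed k (BAll t p) \<longleftrightarrow> closed_tm k t \<and> closed (Suc k) p"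
  by (simp add: BAll_def)

lemma closed_BEx [simp]: "closed k (BEx t p) \<longleftrightarrow> closed_tm k t \<and> closed (Suc k) p"
  by (simp add: BEx_def)

lemma val_num [simp]: "val e (num n) = n"
  by (induction n) auto

lemma closed_num [simp]: "closed_tm k (num n)"
  by (induction n) auto

definition marked_fm :: "tm \<Rightarrow> tm \<Rightarrow> tm \<Rightarrow> tm \<Rightarrow> fm" where
  "marked_fm d w i z =
     BEx w (Eq (Times (Var 0) (lift_tm (Succ (Times (Succ (Plus (Times (Plus i z) (Plus i z)) i)) d))))
       (lift_tm w))"

lemma sat_marked_fm [simp]:
  "sat e (marked_fm d w i z) \<longleftrightarrow> marked (val e d) (val e w) (val e i) (val e z)"
proof -
  have "(\<exists>q\<le>v. q * Suc m = v) \<longleftrightarrow> Suc m dvd v" for m v :: nat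
    by (metis dvd_def dvd_triv_right le_add1 mult.commute mult_Suc_right)
  from this[of "val e w" "pos (val e i) (val e z) * val e d"]
  show ?thesis unfolding marked_def by (simp add: marked_fm_def pos_def)
qed

lemma sat_And: "sat e (And p q) \<longleftrightarrow> sat e p \<and> sat e q"
  by simp

definition numeral_trace_fm :: "tm \<Rightarrow> tm \<Rightarrow> tm \<Rightarrow> tm \<Rightarrow> fm" where
  "numeral_trace_fm d w x c = And (marked_fm d w x c)
     (BAll x (BAll (lift_tm c)
       (Imp (marked_fm (lift_tm (lift_tm d)) (lift_tm (lift_tm w)) (Var 1) (Var 0))
         (Or (And (Eq (Var 1) Zero) (Eq (Var 0) (num 1)))
           (BEx (Var 1) (BEx (Var 1)
             (And (Eq (Var 3) (Succ (Var 1)))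
               (And (Eq (Var 2) (Plus (Times (num 5) (Var 0)) (num 2)))
                 (marked_fm (lift_tm (lift_tm (lift_tm (lift_tm d))))
                   (lift_tm (lift_tm (lift_tm (lift_tm w)))) (Var 1) (Var 0))))))))))"

lemma sat_numeral_trace_fm [simp]:
  "sat e (numeral_trace_fm d w x c) \<longleftrightarrow> numeral_trace (val e d) (val e w) (val e x) (val e c)"
  unfolding numeral_trace_fm_def numeral_trace_def sat_And by (simp add: sat_And disj_imp)

text \<open>The witness \<open>b\<close> bounds a trace \<open>d, w\<close>, the code \<open>c\<close> of the numeral of \<open>x\<close>, and the values \<open>u\<close>
  and \<open>v\<close> of the two triangular numbers that the pairings in \<open>diag_code\<close> involve. Inside the
  quantifiers the indices 0 to 7 stand for \<open>v, u, c, w, d, y, b, x\<close>.\<close>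

definition diag_fm :: fm where
  "diag_fm = BEx (Var 1) (BEx (Var 2) (BEx (Var 3) (BEx (Var 4) (BEx (Var 5)
     (And (numeral_trace_fm (Var 4) (Var 3) (Var 7) (Var 2))
       (And (Eq (Times (num 2) (Var 1)) (Times (Var 2) (Succ (Var 2))))
         (And (Eq (Times (num 2) (Var 0))
              (Times (Plus (Times (num 5) (Var 1)) (Var 7)) (Succ (Plus (Times (num 5) (Var 1)) (Var 7)))))
            (Eq (Var 5) (Plus (Times (num 25) (Plus (Var 0) (Times (num 5) (Var 1)))) (num 19))))))))))"

lemma Delta0_diag_fm: "Delta0 diag_fm"
  unfolding diag_fm_def numeral_trace_fm_def marked_fm_def
  by (intro Delta0.intros Delta0_BAll Delta0_BEx)

lemma closed_diag_fm: "closed 3 diag_fm"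
  unfolding diag_fm_def numeral_trace_fm_def marked_fm_def by simp

lemma sat_diag_fm:
  "sat (env3 y b x) diag_fm \<longleftrightarrow> (\<exists>d\<le>b. \<exists>w\<le>b. \<exists>c\<le>b. \<exists>u\<le>b. \<exists>v\<le>b.
     numeral_trace d w x c \<and> 2 * u = c * Suc c \<and> 2 * v = (5 * u + x) * Suc (5 * u + x) \<and>
     y = 25 * (v + 5 * u) + 19)"
  by (simp add: diag_fm_def conj_ac)

lemma two_triangle: "2 * u = n * Suc n \<longleftrightarrow> u = triangle n"
proof -
  have "2 * triangle n = n * Suc n" by (simp add: triangle_def)
  then show ?thesis by linarith
qed

lemma diag_code_triangle:
  "diag_code x = 25 * (triangle (5 * triangle (code_tm (num x)) + x) + 5 * triangle (code_tm (num x))) + 19"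
  by (simp add: diag_code_def prod_encode_def)

lemma diag_fm_sound: "sat (env3 y b x) diag_fm \<Longrightarrow> y = diag_code x"
  unfolding sat_diag_fm two_triangle diag_code_triangle using numeral_trace_unique by blast

lemma diag_fm_total: "\<exists>b\<ge>diag_code x. sat (env3 (diag_code x) b x) diag_fm"
proof -
  obtain d w where dw: "numeral_trace d w x (code_tm (num x))" using numeral_trace_exists by blast
  define c where "c = code_tm (num x)"
  define u where "u = triangle c"
  define v where "v = triangle (5 * u + x)"
  have *: "numeral_trace d w x c" "u = triangle c" "v = triangle (5 * u + x)" "diag_code x = 25 * (v + 5 * u) + 19"
    using dw by (simp_all add: c_def u_def v_def diag_code_triangle)
  define b where "b = diag_code x + d + w + c + u + v"
  have "d \<le> b" "w \<le> b" "c \<le> b" "u \<le> b" "v \<le> b" "diag_code x \<le> b" by (simp_all add: b_def)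
  then show ?thesis unfolding sat_diag_fm two_triangle using * by blast
qed

section \<open>Fixed points\<close>

lemma holds_diag:
  assumes "wf_struct M"
  shows "holds M e (diag p) \<longleftrightarrow> holds M (case_nat (std M (code p)) e) p"
  using std_in_univ[OF assms] by (auto simp: diag_def)

lemma closed_diag: "closed 1 p \<Longrightarrow> sentence (diag p)"
  by (simp add: diag_def)

lemma sentences_Q: "h \<in> Q \<Longrightarrow> sentence h"
  by (auto simp: Q_def)

lemma closed_least_witness_diag_fm: "closed 3 (least_witness diag_fm)"
  by (rule closed_least_witness[OF closed_diag_fm])

lemma holds_closed_1: "closed 1 \<chi> \<Longrightarrow> holds M (case_nat y e) \<chi> = holds M (case_nat y e') \<chi>"
  by (rule holds_cong) auto

lemma holds_sentence: "sentence p \<Longrightarrow> holds M e p = holds M e' p"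
  by (rule holds_cong) auto

lemma diag_representable:
  assumes "model M Q" "y \<in> univ M"
  shows "(\<exists>b\<in>univ M. holds M (case_nat y (case_nat b (case_nat (std M x) e))) (least_witness diag_fm))
    \<longleftrightarrow> y = std M (diag_code x)"
  unfolding holds_env3[OF closed_least_witness_diag_fm]
  by (rule representable[where f = diag_code, OF assms(1) Delta0_diag_fm closed_diag_fm])
    (fact diag_fm_sound diag_fm_total assms(2))+

lemma least_witness_diag_fms: 
  "least_witness diag_fm \<in> Sigma_fms n" "least_witness diag_fm \<in> Pi_fms n"
  using Delta0_least_witness[OF Delta0_diag_fm] Sigma_fms_mono[of 0 n] Pi_fms_mono[of 0 n]
  by (auto intro: strict_Sigma_fms strict_Pi_fms strict_Sigma_strict_Pi.intros)

text \<open>It is enough that \<open>\<delta>(x)\<close> expresses \<open>\<chi>(diag_code x)\<close> at standard \<open>x\<close>, as \<open>\<delta>\<close> is applied to its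
  own code only.\<close>

lemma diag_fixed_point:
  assumes "closed 1 \<delta>" "closed 1 \<chi>"
    and "\<And>(M :: tm struct) e x. model M Q \<Longrightarrow> assignment M e \<Longrightarrow>
      holds M (case_nat (std M x) e) \<delta> \<longleftrightarrow> holds M (case_nat (std M (diag_code x)) e) \<chi>"
  shows "Q \<turnstile> Iff (diag \<delta>) (inst \<chi> (num (code (diag \<delta>))))"
proof (rule completeness[OF sentences_Q])
  fix M :: "tm struct" and e assume "model M Q" "assignment M e"
  then show "holds M e (Iff (diag \<delta>) (inst \<chi> (num (code (diag \<delta>)))))"
    using assms(3) by (simp add: holds_diag model_def holds_inst code_diag del: holds.simps)
qed

text \<open>As \<open>Q\<close> proves that the diagonal function has exactly one value at a standard argument, this value
  can be introduced by universal or by existential quantifiers. The choice keeps \<open>\<delta>\<close> in the class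
  of \<open>\<chi>\<close>: universal quantifiers for \<open>\<Pi>\<close>, existential ones for \<open>\<Sigma>\<close> in \<open>fixed_point_Sigma\<close>.\<close>

lemma fixed_point_Pi:
  assumes "\<chi> \<in> Pi_fms (Suc n)" "closed 1 \<chi>"
  shows "\<exists>\<rho>\<in>Pi_sentences (Suc n). Q \<turnstile> Iff \<rho> (inst \<chi> (num (code \<rho>)))"
proof
  define \<delta> where "\<delta> = All (All (Imp (least_witness diag_fm) \<chi>))"
  have \<delta>: "\<delta> \<in> Pi_fms (Suc n)"
    unfolding \<delta>_def by (intro All_Pi_fms Imp_Pi_fms least_witness_diag_fms assms)
  have cl: "closed 1 \<delta>"
    using assms(2) closed_least_witness_diag_fm closed_mono[of 1 \<chi> 3]
    by (simp add: \<delta>_def numeral_3_eq_3)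
  show "Q \<turnstile> Iff (diag \<delta>) (inst \<chi> (num (code (diag \<delta>))))"
  proof (rule diag_fixed_point[OF cl assms(2)])
    fix M :: "tm struct" and e x assume M: "model M Q" and e: "assignment M e"
    have \<chi>: "holds M (case_nat y (case_nat b e')) \<chi> = holds M (case_nat y e) \<chi>" for y b e'
      by (rule holds_closed_1[OF assms(2)])
    have "holds M (case_nat (std M x) e) \<delta> \<longleftrightarrow> (\<forall>y\<in>univ M. (\<exists>b\<in>univ M.
        holds M (case_nat y (case_nat b (case_nat (std M x) e))) (least_witness diag_fm)) \<longrightarrow>
        holds M (case_nat y e) \<chi>)"
      unfolding \<delta>_def by (auto simp: \<chi>)
    then show "holds M (case_nat (std M x) e) \<delta> \<longleftrightarrow> holds M (case_nat (std M (diag_code x)) e) \<chi>"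
      using diag_representable[OF M] stdM[OF M] by auto
  qed
  have "diag \<delta> \<in> Pi_fms (Suc n)"
    by (rule Pi_fms_cong[OF subst_Pi_fms[OF \<delta>, of "case_nat (num (code \<delta>)) Var"]])
      (simp add: holds_diag holds_inst)
  then show "diag \<delta> \<in> Pi_sentences (Suc n)" using closed_diag[OF cl] by (simp add: Pi_sentences_def)
qed

lemma fixed_point_Sigma:
  assumes "\<chi> \<in> Sigma_fms (Suc n)" "closed 1 \<chi>"
  shows "\<exists>\<rho>\<in>Sigma_sentences (Suc n). Q \<turnstile> Iff \<rho> (inst \<chi> (num (code \<rho>)))"
proof
  define \<delta> where "\<delta> = Ex (Ex (And (least_witness diag_fm) \<chi>))"
  have \<delta>: "\<delta> \<in> Sigma_fms (Suc n)"
    unfolding \<delta>_def by (intro Ex_Sigma_fms And_Sigma_fms least_witness_diag_fms assms)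
  have cl: "closed 1 \<delta>"
    using assms(2) closed_least_witness_diag_fm closed_mono[of 1 \<chi> 3]
    by (simp add: \<delta>_def numeral_3_eq_3)
  show "Q \<turnstile> Iff (diag \<delta>) (inst \<chi> (num (code (diag \<delta>))))"
  proof (rule diag_fixed_point[OF cl assms(2)])
    fix M :: "tm struct" and e x assume M: "model M Q" and e: "assignment M e"
    have \<chi>: "holds M (case_nat y (case_nat b e')) \<chi> = holds M (case_nat y e) \<chi>" for y b e'
      by (rule holds_closed_1[OF assms(2)])
    have "holds M (case_nat (std M x) e) \<delta> \<longleftrightarrow> (\<exists>y\<in>univ M. (\<exists>b\<in>univ M.
        holds M (case_nat y (case_nat b (case_nat (std M x) e))) (least_witness diag_fm)) \<and>
        holds M (case_nat y e) \<chi>)"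
      unfolding \<delta>_def by (auto simp: \<chi>)
    then show "holds M (case_nat (std M x) e) \<delta> \<longleftrightarrow> holds M (case_nat (std M (diag_code x)) e) \<chi>"
      using diag_representable[OF M] stdM[OF M] by auto
  qed
  have "diag \<delta> \<in> Sigma_fms (Suc n)"
    by (rule Sigma_fms_cong[OF subst_Sigma_fms[OF \<delta>, of "case_nat (num (code \<delta>)) Var"]])
      (simp add: holds_diag holds_inst)
  then show "diag \<delta> \<in> Sigma_sentences (Suc n)" using closed_diag[OF cl] by (simp add: Sigma_sentences_def)
qed

section \<open>Rosserian sentences\<close>

lemma true_in_N_holds: "sentence p \<Longrightarrow> true_in_N p \<longleftrightarrow> holds nat_struct e p"
  unfolding true_in_N_def holds_nat_struct[symmetric] by (rule holds_sentence)

lemma holds_inst2: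
  assumes "closed 2 P"
  shows "holds M e (inst2 P s t) \<longleftrightarrow> holds M (case_nat (ev M e s) (\<lambda>_. ev M e t)) P"
proof -
  have "(\<lambda>i. ev M e (case_nat s (case_nat t Var) i)) = case_nat (ev M e s) (case_nat (ev M e t) e)"
    by (auto split: nat.split)
  then show ?thesis
    unfolding holds_subst
    by (auto intro!: holds_cong[OF assms] simp: less_Suc_eq numeral_eq_Suc)
qed

lemma holds_rosser:
  assumes "closed 2 P"
  shows "holds M e (rosser P s t) \<longleftrightarrow> (\<exists>y\<in>univ M. holds M (case_nat y (\<lambda>_. ev M e s)) P \<and>
    (\<forall>z\<in>univ M. leq M z y \<longrightarrow> z \<noteq> y \<longrightarrow> \<not> holds M (case_nat z (\<lambda>_. ev M e t)) P))"
  by (auto simp: rosser_def holds_inst2[OF assms] ev_subst)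

text \<open>In \<open>RPr\<close> the code of the negation is a term in the argument, in \<open>RPr_at\<close> it is a numeral; they
  have the same value in every model of \<open>Q\<close>.\<close>

lemma holds_RPr_at:
  assumes M: "model M Q" and "closed 2 P"
  shows "holds M e (RPr_at P p) \<longleftrightarrow> holds M (case_nat (std M (code p)) e') (RPr P)"
proof -
  have "ev M (case_nat (std M (code p)) e') (neg_tm (Var 0)) = std M (code (Neg p))"
    using mul_std[OF M, of 5 "code p"] by (simp add: neg_tm_def std_simps)
  then show ?thesis unfolding RPr_def RPr_at_def holds_rosser[OF assms(2)] ev_num by simp
qed

text \<open>The \<open>\<Sigma>\<^sub>1\<close>-formula that is \<open>Q\<close>-equivalent to \<open>RPr P\<close> may have further free variables, which are
  replaced by \<open>Zero\<close>.\<close>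

lemma RPr_Sigma:
  assumes "Q_equiv_to (Sigma_fms 1) (RPr P)" "closed 2 P"
  obtains \<sigma> where "\<sigma> \<in> Sigma_fms 1" "closed 1 \<sigma>"
    "\<And>r. Q \<turnstile> Iff (RPr_at P r) (inst \<sigma> (num (code r)))"
proof -
  from assms(1) obtain q where q: "q \<in> Sigma_fms 1" "Q \<turnstile> Iff (RPr P) q"
    by (auto simp: Q_equiv_to_def)
  define \<sigma> where "\<sigma> = subst (case_nat (Var 0) (\<lambda>_. Zero)) q"
  show thesis
  proof
    show "\<sigma> \<in> Sigma_fms 1" unfolding \<sigma>_def by (rule subst_Sigma_fms[OF q(1)])
    obtain k where "closed k q" using ex_closed by blast
    then show "closed 1 \<sigma>" unfolding \<sigma>_def by (rule closed_subst) (auto split: nat.split)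
    fix r
    show "Q \<turnstile> Iff (RPr_at P r) (inst \<sigma> (num (code r)))"
    proof (rule completeness[OF sentences_Q])
      fix M :: "tm struct" and e assume M: "model M Q" and e: "assignment M e"
      let ?e = "case_nat (std M (code r)) (\<lambda>_. null M)"
      have "(\<lambda>i. ev M (case_nat (std M (code r)) e) (case_nat (Var 0) (\<lambda>_. Zero) i)) = ?e"
        by (auto split: nat.split)
      then have "holds M e (inst \<sigma> (num (code r))) \<longleftrightarrow> holds M ?e q"
        by (simp add: \<sigma>_def holds_subst[of M _ "case_nat (Var 0) (\<lambda>_. Zero)"] holds_inst)
      moreover have "holds M ?e (Iff (RPr P) q)"
        by (rule soundness_model[OF q(2) M])
          (use M stdM[OF M] in \<open>auto simp: assignment_def model_def wf_struct_def split: nat.split\<close>)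
      moreover have "holds M e (RPr_at P r) \<longleftrightarrow> holds M ?e (RPr P)"
        by (rule holds_RPr_at[OF M assms(2)])
      ultimately show "holds M e (Iff (RPr_at P r) (inst \<sigma> (num (code r))))" by simp
    qed
  qed
qed

lemma RPr_at_true_iff:
  assumes "closed 2 P"
  shows "holds nat_struct e (RPr_at P r) \<longleftrightarrow>
    (\<exists>m. holds nat_struct e (inst2 P (num m) (num (code r))) \<and>
      (\<forall>k<m. \<not> holds nat_struct e (inst2 P (num k) (num (code (Neg r))))))"
  unfolding RPr_at_def holds_rosser[OF assms] holds_inst2[OF assms] ev_num std_nat_struct
  by (auto simp: nat_struct_def)

text \<open>The argument for an arbitrary class \<open>\<Gamma>\<close> with the closure properties and fixed points that it
  uses. The formula \<open>\<sigma>\<close> is a \<open>\<Sigma>\<^sub>1\<close>-form of the Rosserian provability predicate; \<open>RPr_at\<close> itself is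
  only \<open>Q\<close>-equivalent to such a formula and may fail to belong to \<open>\<Gamma>\<close>.\<close>

theorem rosserian_true_iff_sound:
  assumes T: "re_extension_of_Q T" and P: "proof_predicate T P"
    and RPr: "Q_equiv_to (Sigma_fms 1) (RPr P)"
    and Sigma: "Sigma_fms 1 \<subseteq> \<Gamma>" and Pi: "Pi_fms 1 \<subseteq> \<Gamma>"
    and And: "\<And>p q. p \<in> \<Gamma> \<Longrightarrow> q \<in> \<Gamma> \<Longrightarrow> And p q \<in> \<Gamma>"
    and Or: "\<And>p q. p \<in> \<Gamma> \<Longrightarrow> q \<in> \<Gamma> \<Longrightarrow> Or p q \<in> \<Gamma>"
    and fixed_point: "\<And>\<chi>. \<chi> \<in> \<Gamma> \<Longrightarrow> closed 1 \<chi> \<Longrightarrow>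
      \<exists>\<rho>\<in>{p \<in> \<Gamma>. sentence p}. Q \<turnstile> Iff \<rho> (inst \<chi> (num (code \<rho>)))"
  shows "(\<forall>r\<in>{p \<in> \<Gamma>. sentence p}. rosserian T P r \<longrightarrow> true_in_N r) \<longleftrightarrow> sound_for {p \<in> \<Gamma>. sentence p} T"
proof -
  have closed_P: "closed 2 P" using P by (simp add: proof_predicate_def)
  obtain \<sigma> where \<sigma>: "\<sigma> \<in> Sigma_fms 1" "closed 1 \<sigma>"
    and RPr_\<sigma>: "\<And>r. Q \<turnstile> Iff (RPr_at P r) (inst \<sigma> (num (code r)))"
    using RPr_Sigma[OF RPr closed_P] by metis
  have sentence_T: "h \<in> T \<Longrightarrow> sentence h" for h
    using T by (simp add: re_extension_of_Q_def)
  have model_T: "model M Q" if "model M T" for M :: "tm struct"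
  proof -
    have "holds M e h" if "h \<in> Q" "assignment M e" for h e
    proof (rule soundness_model[OF _ \<open>model M T\<close> that(2)])
      show "T \<turnstile> h" using T that(1) sentences_Q by (auto simp: re_extension_of_Q_def intro: Assm)
    qed
    then show ?thesis using that by (simp add: model_def)
  qed
  have RPr_eq: "holds M e (RPr_at P r) \<longleftrightarrow> holds M e (inst \<sigma> (num (code r)))"
    if "model M T" "assignment M e" for M :: "tm struct" and e r
    using soundness_model[OF RPr_\<sigma> model_T] that by (simp del: holds.simps)
  have RPr_eq_N: "holds nat_struct e (RPr_at P r) \<longleftrightarrow> holds nat_struct e (inst \<sigma> (num (code r)))" for e r
    using soundness_model[OF RPr_\<sigma> model_nat_struct_Q assignment_nat_struct] by (simp del: holds.simps)
  have rosserianD: "holds M e r \<longleftrightarrow> \<not> holds M e (inst \<sigma> (num (code r)))"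
    if "rosserian T P r" "model M T" "assignment M e" for M :: "tm struct" and e r
  proof -
    have "holds M e (Iff r (Neg (RPr_at P r)))"
      using that by (intro soundness_model[of T]) (simp_all add: rosserian_def)
    then show ?thesis using RPr_eq[OF that(2,3)] by auto
  qed
  let ?e = "\<lambda>_. 0 :: nat"
  show ?thesis
  proof
    assume true: "\<forall>r\<in>{p \<in> \<Gamma>. sentence p}. rosserian T P r \<longrightarrow> true_in_N r"
    show "sound_for {p \<in> \<Gamma>. sentence p} T"
      unfolding sound_for_def
    proof (intro ballI impI)
      fix \<psi> assume "\<psi> \<in> {p \<in> \<Gamma>. sentence p}" and T_\<psi>: "T \<turnstile> \<psi>"
      then have \<psi>: "\<psi> \<in> \<Gamma>" "sentence \<psi>" by auto
      let ?\<chi> = "And \<psi> (Neg \<sigma>)"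
      have "?\<chi> \<in> \<Gamma>" using And \<psi>(1) Pi Neg_Sigma_fms[OF \<sigma>(1)] by blast
      moreover have "closed 1 ?\<chi>" using \<psi>(2) \<sigma>(2) closed_mono[of 0 \<psi> 1] by simp
      ultimately obtain \<rho> where \<rho>: "\<rho> \<in> \<Gamma>" "sentence \<rho>" and fp: "Q \<turnstile> Iff \<rho> (inst ?\<chi> (num (code \<rho>)))"
        using fixed_point by blast
      have inst_\<psi>: "holds M e (inst \<psi> t) \<longleftrightarrow> holds M e \<psi>" for M :: "'b struct" and e t
        unfolding holds_inst by (rule holds_sentence[OF \<psi>(2)])
      have "T \<turnstile> Iff \<rho> (Neg (RPr_at P \<rho>))"
      proof (rule completeness[OF sentence_T])
        fix M :: "tm struct" and e assume M: "model M T" and e: "assignment M e"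
        have "holds M e \<psi>" by (rule soundness_model[OF T_\<psi> M e])
        moreover have "holds M e (Iff \<rho> (inst ?\<chi> (num (code \<rho>))))"
          by (rule soundness_model[OF fp model_T[OF M] e])
        ultimately show "holds M e (Iff \<rho> (Neg (RPr_at P \<rho>)))"
          using RPr_eq[OF M e] by (auto simp: inst_\<psi>)
      qed
      then have "rosserian T P \<rho>" using \<rho> by (simp add: rosserian_def)
      then have "true_in_N \<rho>" using true \<rho> by blast
      then have "holds nat_struct ?e \<rho>" using true_in_N_holds \<rho>(2) by blast
      moreover have "holds nat_struct ?e (Iff \<rho> (inst ?\<chi> (num (code \<rho>))))"
        by (rule soundness_model[OF fp model_nat_struct_Q assignment_nat_struct])
      ultimately have "holds nat_struct ?e \<psi>" by (simp add: inst_\<psi>)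
      then show "true_in_N \<psi>" using true_in_N_holds \<psi>(2) by blast
    qed
  next
    assume sound: "sound_for {p \<in> \<Gamma>. sentence p} T"
    then have soundD: "holds nat_struct ?e p" if "T \<turnstile> p" "p \<in> \<Gamma>" "sentence p" for p
      using that true_in_N_holds[of p ?e] by (auto simp: sound_for_def)
    have proved: "\<exists>m. Q \<turnstile> inst2 P (num m) (num (code p))" if "T \<turnstile> p" "sentence p" for p
      using P that unfolding proof_predicate_def by blast
    have Q_true: "holds nat_struct ?e p" if "Q \<turnstile> p" for p
      by (rule soundness_model[OF that model_nat_struct_Q assignment_nat_struct])
    have unproved: "\<not> holds nat_struct ?e (inst2 P (num m) (num (code p)))"
      if "\<not> T \<turnstile> p" "sentence p" for p m
    proof -
      have "Q \<turnstile> Neg (inst2 P (num m) (num (code p)))"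
        using P that unfolding proof_predicate_def by blast
      then show ?thesis using Q_true by fastforce
    qed
    show "\<forall>r\<in>{p \<in> \<Gamma>. sentence p}. rosserian T P r \<longrightarrow> true_in_N r"
    proof (intro ballI impI)
      fix r assume "r \<in> {p \<in> \<Gamma>. sentence p}" and ross: "rosserian T P r"
      then have r: "r \<in> \<Gamma>" "sentence r" by auto
      define R where "R = inst \<sigma> (num (code r))"
      have R: "R \<in> Sigma_fms 1" "sentence R"
        using subst_Sigma_fms[OF \<sigma>(1)] closed_subst[OF \<sigma>(2), of 0] by (auto simp: R_def)
      have R_true: "holds nat_struct ?e R \<longleftrightarrow> holds nat_struct ?e (RPr_at P r)"
        using RPr_eq_N by (simp add: R_def)
      have "\<not> T \<turnstile> r"
      proof
        assume T_r: "T \<turnstile> r"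
        have "T \<turnstile> Neg R"
        proof (rule completeness[OF sentence_T])
          fix M :: "tm struct" and e assume M: "model M T" and e: "assignment M e"
          show "holds M e (Neg R)"
            using rosserianD[OF ross M e] soundness_model[OF T_r M e] by (simp add: R_def)
        qed
        moreover have "Neg R \<in> \<Gamma>" using Pi Neg_Sigma_fms[OF R(1)] by blast
        ultimately have not_RPr: "\<not> holds nat_struct ?e (RPr_at P r)"
          using soundD[of "Neg R"] R(2) R_true by simp
        have "\<not> T \<turnstile> Neg r"
        proof
          assume "T \<turnstile> Neg r"
          \<comment> \<open>The falsity \<open>0 = 1\<close> serves as a provable sentence of the class that is not true.\<close>
          then have "\<not> consistent T" using T_r by (auto simp: consistent_def)
          then have "T \<turnstile> Eq Zero (Succ Zero)" by (rule inconsistent_derives)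
          moreover have "Eq Zero (Succ Zero) \<in> Sigma_fms 1"
            using Sigma_fms_mono[of 0 1]
            by (auto intro: strict_Sigma_fms strict_Sigma_strict_Pi.intros Delta0.intros)
          ultimately have "holds nat_struct ?e (Eq Zero (Succ Zero))" using Sigma by (intro soundD) auto
          then show False by (simp add: nat_struct_def)
        qed
        then have "\<not> holds nat_struct ?e (inst2 P (num k) (num (code (Neg r))))" for k
          by (rule unproved) (simp add: r(2))
        moreover obtain m where "holds nat_struct ?e (inst2 P (num m) (num (code r)))"
          using proved[OF T_r r(2)] Q_true by blast
        ultimately show False using not_RPr RPr_at_true_iff[OF closed_P] by blast
      qed
      then have "\<not> holds nat_struct ?e (inst2 P (num m) (num (code r)))" for m
        using r(2) by (rule unproved)
      then have R_false: "\<not> holds nat_struct ?e R"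
        using R_true RPr_at_true_iff[OF closed_P] by blast
      have "T \<turnstile> Or r R"
      proof (rule completeness[OF sentence_T])
        fix M :: "tm struct" and e assume M: "model M T" and e: "assignment M e"
        show "holds M e (Or r R)" using rosserianD[OF ross M e] by (simp add: R_def)
      qed
      moreover have "Or r R \<in> \<Gamma>" using Or r(1) R(1) Sigma by blast
      ultimately have "holds nat_struct ?e (Or r R)" using r(2) R(2) by (intro soundD) simp_all
      then show "true_in_N r" using R_false r(2) true_in_N_holds[of r ?e] by simp
    qed
  qed
qed

theorem theorem3p9:
  fixes T :: "fm set" and P :: fm and n :: nat
  assumes "re_extension_of_Q T"
    and "proof_predicate T P"
    and "Q_equiv_to (Sigma_fms 1) (RPr P)"
    and "n \<ge> 1"
  shows "((\<forall>r \<in> Pi_sentences (n + 1). rosserian T P r \<longrightarrow> true_in_N r)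
            \<longleftrightarrow> sound_for (Pi_sentences (n + 1)) T)
       \<and> ((\<forall>r \<in> Sigma_sentences (n + 1). rosserian T P r \<longrightarrow> true_in_N r)
            \<longleftrightarrow> sound_for (Sigma_sentences (n + 1)) T)"
proof
  have incl: "Sigma_fms 1 \<subseteq> Pi_fms (n + 1)" "Pi_fms 1 \<subseteq> Pi_fms (n + 1)"
    "Sigma_fms 1 \<subseteq> Sigma_fms (n + 1)" "Pi_fms 1 \<subseteq> Sigma_fms (n + 1)"
    using \<open>n \<ge> 1\<close> Sigma_fms_mono[of 1 n] Pi_fms_mono[of 1 n] Sigma_fms_mono[of 1 "n + 1"]
      Pi_fms_mono[of 1 "n + 1"] Sigma_fms_subset_Pi_fms[of n] Pi_fms_subset_Sigma_fms[of n] by auto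
  show "(\<forall>r \<in> Pi_sentences (n + 1). rosserian T P r \<longrightarrow> true_in_N r)
      \<longleftrightarrow> sound_for (Pi_sentences (n + 1)) T"
    unfolding Pi_sentences_def
    by (rule rosserian_true_iff_sound[OF assms(1-3) incl(1,2)])
      (use fixed_point_Pi[of _ n] in \<open>auto simp: Pi_sentences_def intro: And_Pi_fms Imp_Pi_fms Neg_Pi_fms\<close>)
  show "(\<forall>r \<in> Sigma_sentences (n + 1). rosserian T P r \<longrightarrow> true_in_N r)
      \<longleftrightarrow> sound_for (Sigma_sentences (n + 1)) T"
    unfolding Sigma_sentences_def
    by (rule rosserian_true_iff_sound[OF assms(1-3) incl(3,4)])
      (use fixed_point_Sigma[of _ n] in \<open>auto simp: Sigma_sentences_def intro: And_Sigma_fms Imp_Sigma_fms Neg_Sigma_fms\<close>)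
qed

end
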